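(* Let $\mathfrak H$ be a Hilbert space. For a projection $p_\Delta\in\mathcal B(\mathfrak H)\otimes\mathcal B(\mathfrak H)'$ the following statements are equivalent: (a) $p_\Delta$ is a maximal diagonal projection. (b) There is an orthonormal basis $(e_i)_{i\in I}$ of $\mathfrak H$ such that $$p_\Delta = \sum_{i\in I} p_i\otimes Jp_iJ,$$ where $p_i\in\mathcal B(\mathfrak H)$ denotes the projection onto $\mathbb C e_i$ and where the sum converges in the $\sigma$-strong topology.
   Context: $\mathcal M=\mathcal B(\mathfrak H)$ is taken in its standard representation, acting by left multiplication on the Hilbert space $\mathrm{HS}(\mathfrak H)$ of Hilbert–Schmidt operators on $\mathfrak H$, with modular conjugation $J\rho=\rho^*$; the commutant is $\mathcal B(\mathfrak H)' = J\mathcal B(\mathfrak H)J$ (right multiplications), and the von Neumann tensor product $\mathcal B(\mathfrak H)\otimes\mathcal B(\mathfrak H)'$ is identified with $\mathcal B(\mathrm{HS}(\mathfrak H))$ via $x\otimes y'\mapsto xy'$. A projection $p_\Delta\in\mathcal M\otimes\mathcal M'$ is called a diagonal projection if $p_\Delta(x\otimes1)p_\Delta = p_\Delta(1\otimes Jx^*J)p_\Delta$ for every $x\in\mathcal M$. It is a maximal diagonal projection if it is maximal, with respect to the usual order of projections, among all diagonal projections in $\mathcal M\otimes\mathcal M'$. *)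

theory Defs
  imports "HOL-Analysis.Analysis"
begin

section \<open>Complex Hilbert spaces\<close>

text \<open>The complex inner product is antilinear in its first argument. Its real part is the inner
  product of the underlying real Hilbert space, so norm, metric and topology are those of
  \<^class>\<open>real_inner\<close>. No separability is assumed, and the zero space is allowed.\<close>

class chilbert_space = real_inner + complete_space +
  fixes scaleC :: "complex \<Rightarrow> 'a \<Rightarrow> 'a"  (infixr "*\<^sub>C" 75)
    and cinner :: "'a \<Rightarrow> 'a \<Rightarrow> complex"
  assumes scaleC_add_right: "c *\<^sub>C (x + y) = c *\<^sub>C x + c *\<^sub>C y"
    and scaleC_add_left: "(c + d) *\<^sub>C x = c *\<^sub>C x + d *\<^sub>C x"
    and scaleC_scaleC: "c *\<^sub>C d *\<^sub>C x = (c * d) *\<^sub>C x"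
    and scaleC_of_real: "complex_of_real r *\<^sub>C x = r *\<^sub>R x"
    and cinner_commute: "cinner x y = cnj (cinner y x)"
    and cinner_add_right: "cinner x (y + z) = cinner x y + cinner x z"
    and cinner_scaleC_right: "cinner x (c *\<^sub>C y) = c * cinner x y"
    and Re_cinner: "Re (cinner x y) = inner x y"
begin

subclass banach ..

end

instantiation complex :: chilbert_space
begin

definition scaleC_complex :: "complex \<Rightarrow> complex \<Rightarrow> complex"
  where "scaleC_complex c x = c * x"

definition cinner_complex :: "complex \<Rightarrow> complex \<Rightarrow> complex"
  where "cinner_complex x y = cnj x * y"

instance
  by standard (simp_all add: scaleC_complex_def cinner_complex_def algebra_simps
      scaleR_conv_of_real inner_complex_def)

end

lemma scaleC_one [simp]: "1 *\<^sub>C (x::'a::chilbert_space) = x"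
  using scaleC_of_real[of 1 x] by simp

global_interpretation complex_vector: vector_space "scaleC :: complex \<Rightarrow> 'a \<Rightarrow> 'a::chilbert_space"
  defines cspan = complex_vector.span
  by standard (simp_all add: scaleC_add_right scaleC_add_left scaleC_scaleC)

lemma cinner_add_left: "cinner (x + y) z = cinner x z + cinner y z" for x :: "'a::chilbert_space"
  by (metis cinner_commute cinner_add_right complex_cnj_add)

lemma cinner_scaleC_left: "cinner (c *\<^sub>C x) y = cnj c * cinner x y" for x :: "'a::chilbert_space"
  by (metis cinner_commute cinner_scaleC_right complex_cnj_mult)

lemma cinner_scaleR_right: "cinner x (r *\<^sub>R y) = r *\<^sub>R cinner x y" for x :: "'a::chilbert_space"
  by (metis cinner_scaleC_right scaleC_of_real scaleR_conv_of_real)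

lemma cinner_scaleR_left: "cinner (r *\<^sub>R x) y = r *\<^sub>R cinner x y" for x :: "'a::chilbert_space"
  by (metis cinner_scaleC_left scaleC_of_real scaleR_conv_of_real complex_cnj_complex_of_real)

lemma cinner_zero_left [simp]: "cinner 0 y = 0" for y :: "'a::chilbert_space"
  using cinner_scaleR_left[of 0 0 y] by simp

lemma cinner_zero_right [simp]: "cinner y 0 = 0" for y :: "'a::chilbert_space"
  using cinner_scaleR_right[of y 0 0] by simp

lemma cinner_self: "cinner x x = complex_of_real ((norm x)\<^sup>2)" for x :: "'a::chilbert_space"
proof (rule complex_eqI)
  show "Re (cinner x x) = Re (complex_of_real ((norm x)\<^sup>2))"
    by (simp add: Re_cinner power2_norm_eq_inner)
  have "Im (cinner x x) = - Im (cinner x x)"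
    by (metis cinner_commute cnj.simps(2))
  then show "Im (cinner x x) = Im (complex_of_real ((norm x)\<^sup>2))"
    by simp
qed

lemma norm_scaleC: "norm (c *\<^sub>C x) = cmod c * norm x" for x :: "'a::chilbert_space"
proof -
  have "complex_of_real ((norm (c *\<^sub>C x))\<^sup>2) = (cnj c * c) * complex_of_real ((norm x)\<^sup>2)"
    unfolding cinner_self[symmetric] by (simp add: cinner_scaleC_left cinner_scaleC_right)
  also have "cnj c * c = complex_of_real ((cmod c)\<^sup>2)"
    by (metis complex_norm_square mult.commute)
  also have "\<dots> * complex_of_real ((norm x)\<^sup>2) = complex_of_real ((cmod c * norm x)\<^sup>2)"
    by (simp add: power_mult_distrib)
  finally have "(norm (c *\<^sub>C x))\<^sup>2 = (cmod c * norm x)\<^sup>2"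
    using of_real_eq_iff by blast
  then show ?thesis
    by simp
qed

lemma cinner_Cauchy_Schwarz: "cmod (cinner x y) \<le> norm x * norm y" for x :: "'a::chilbert_space"
proof (cases "cinner x y = 0")
  case True
  then show ?thesis by simp
next
  case False
  define c where "c = cnj (cinner x y) / complex_of_real (cmod (cinner x y))"
  have c: "cmod c = 1"
    using False by (simp add: c_def norm_divide)
  have "c * cinner x y = complex_of_real ((cmod (cinner x y))\<^sup>2) / complex_of_real (cmod (cinner x y))"
    unfolding c_def by (metis complex_norm_square mult.commute times_divide_eq_left)
  also have "\<dots> = complex_of_real (cmod (cinner x y))"
    using False by (simp add: power2_eq_square)
  finally have "cmod (cinner x y) = Re (cinner x (c *\<^sub>C y))"
    by (simp add: cinner_scaleC_right)
  also have "\<dots> = inner x (c *\<^sub>C y)"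
    by (rule Re_cinner)
  also have "\<dots> \<le> norm x * norm (c *\<^sub>C y)"
    by (rule norm_cauchy_schwarz)
  finally show ?thesis
    by (simp add: norm_scaleC c)
qed

lemma bounded_linear_cinner_right: "bounded_linear (cinner x)" for x :: "'a::chilbert_space"
  by (rule bounded_linear_intro[where K = "norm x"])
    (simp_all add: cinner_add_right cinner_scaleR_right cinner_Cauchy_Schwarz mult.commute[of "norm _" "norm x"])

lemma bounded_linear_cinner_left: "bounded_linear (\<lambda>x. cinner x y)" for y :: "'a::chilbert_space"
  by (rule bounded_linear_intro[where K = "norm y"])
    (simp_all add: cinner_add_left cinner_scaleR_left cinner_Cauchy_Schwarz)

lemma bounded_linear_scaleC_right: "bounded_linear (\<lambda>x::'a::chilbert_space. c *\<^sub>C x)"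
proof (rule bounded_linear_intro[where K = "cmod c"])
  show "c *\<^sub>C (r *\<^sub>R x) = r *\<^sub>R (c *\<^sub>C x)" for r and x :: 'a
    by (metis scaleC_of_real scaleC_scaleC mult.commute)
qed (simp_all add: scaleC_add_right norm_scaleC)

lemmas cinner_sum_right = linear_sum[OF bounded_linear.linear[OF bounded_linear_cinner_right]]
lemmas cinner_sum_left = linear_sum[OF bounded_linear.linear[OF bounded_linear_cinner_left]]
lemmas cinner_diff_right = linear_diff[OF bounded_linear.linear[OF bounded_linear_cinner_right]]
lemmas cinner_diff_left = linear_diff[OF bounded_linear.linear[OF bounded_linear_cinner_left]]

lemma cmod_cinner_commute: "cmod (cinner x y) = cmod (cinner y x)" for x :: "'a::chilbert_space"
  by (subst cinner_commute) simp

lemma cinner_eqI: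
  fixes x y :: "'a::chilbert_space"
  assumes "\<And>z. cinner x z = cinner y z"
  shows "x = y"
proof -
  have "cinner (x - y) (x - y) = 0"
    using assms[of "x - y"] by (simp add: cinner_diff_left)
  then show ?thesis
    by (simp add: cinner_self)
qed


section \<open>Orthonormal bases\<close>

definition orthonormal_family :: "'i set \<Rightarrow> ('i \<Rightarrow> 'a::chilbert_space) \<Rightarrow> bool"
  where "orthonormal_family I e \<longleftrightarrow>
    (\<forall>i\<in>I. \<forall>j\<in>I. cinner (e i) (e j) = (if i = j then 1 else 0))"

definition orthonormal_basis :: "'i set \<Rightarrow> ('i \<Rightarrow> 'a::chilbert_space) \<Rightarrow> bool"
  where "orthonormal_basis I e \<longleftrightarrow> orthonormal_family I e \<and> closure (cspan (e ` I)) = UNIV"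

lemma orthonormal_basis_family: "orthonormal_basis I e \<Longrightarrow> orthonormal_family I e"
  by (simp add: orthonormal_basis_def)

lemma orthonormal_norm_sum:
  fixes e :: "'i \<Rightarrow> 'a::chilbert_space"
  assumes "orthonormal_family I e" "finite F" "F \<subseteq> I"
  shows "(norm (\<Sum>i\<in>F. c i *\<^sub>C e i))\<^sup>2 = (\<Sum>i\<in>F. (cmod (c i))\<^sup>2)"
proof -
  have "complex_of_real ((norm (\<Sum>i\<in>F. c i *\<^sub>C e i))\<^sup>2)
      = (\<Sum>i\<in>F. \<Sum>j\<in>F. cnj (c i) * (c j * cinner (e i) (e j)))"
    unfolding cinner_self[symmetric]
    by (simp add: cinner_sum_left cinner_sum_right cinner_scaleC_left cinner_scaleC_right sum_distrib_left)
      (subst sum.swap, simp add: mult.left_commute)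
  also have "\<dots> = (\<Sum>i\<in>F. \<Sum>j\<in>F. if i = j then cnj (c i) * c i else 0)"
    using assms by (intro sum.cong refl) (auto simp: orthonormal_family_def subset_iff)
  also have "\<dots> = (\<Sum>i\<in>F. complex_of_real ((cmod (c i))\<^sup>2))"
    using \<open>finite F\<close> by (simp add: complex_norm_square mult.commute del: of_real_power)
  finally show ?thesis
    unfolding of_real_sum[symmetric] using of_real_eq_iff by blast
qed

lemma orthonormal_summable:
  fixes e :: "'i \<Rightarrow> 'a::chilbert_space"
  assumes on: "orthonormal_family I e" and sq: "(\<lambda>i. (cmod (c i))\<^sup>2) summable_on I"
  shows "(\<lambda>i. c i *\<^sub>C e i) summable_on I"
proof -
  let ?s = "\<lambda>F. \<Sum>i\<in>F. c i *\<^sub>C e i"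
  define L where "L = (\<Sum>\<^sub>\<infinity>i\<in>I. (cmod (c i))\<^sup>2)"
  have L: "((\<lambda>i. (cmod (c i))\<^sup>2) has_sum L) I"
    using sq by (simp add: L_def)
  have "\<exists>P. eventually P (finite_subsets_at_top I) \<and>
              (\<forall>F F'. P F \<and> P F' \<longrightarrow> dist (?s F) (?s F') < d)" if "d > 0" for d
  proof -
    have "(d / 3)\<^sup>2 > 0"
      using that by simp
    then obtain F0 where F0: "finite F0" "F0 \<subseteq> I" "dist (\<Sum>i\<in>F0. (cmod (c i))\<^sup>2) L \<le> (d / 3)\<^sup>2"
      using has_sum_finite_approximation[OF L] by blast
    define P where "P F \<longleftrightarrow> finite F \<and> F0 \<subseteq> F \<and> F \<subseteq> I" for F
    have close: "dist (?s F) (?s F0) \<le> d / 3" if "P F" for F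
    proof -
      have F: "finite F" "F0 \<subseteq> F" "F \<subseteq> I"
        using that by (auto simp: P_def)
      have "?s F - ?s F0 = ?s (F - F0)"
        using F by (simp add: sum_diff)
      then have "(dist (?s F) (?s F0))\<^sup>2 = (\<Sum>i\<in>F - F0. (cmod (c i))\<^sup>2)"
        using orthonormal_norm_sum[OF on, of "F - F0" c] F by (auto simp: dist_norm)
      also have "\<dots> = (\<Sum>i\<in>F. (cmod (c i))\<^sup>2) - (\<Sum>i\<in>F0. (cmod (c i))\<^sup>2)"
        using F by (simp add: sum_diff)
      also have "(\<Sum>i\<in>F. (cmod (c i))\<^sup>2) \<le> L"
        using F by (intro finite_sum_le_has_sum[OF L]) auto
      finally have "(dist (?s F) (?s F0))\<^sup>2 \<le> (d / 3)\<^sup>2"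
        using F0(3) by (auto simp: dist_real_def)
      then show ?thesis
        using \<open>d > 0\<close> by (meson abs_le_square_iff abs_of_nonneg divide_nonneg_pos less_imp_le
            power2_le_imp_le zero_less_numeral)
    qed
    have "eventually P (finite_subsets_at_top I)"
      unfolding eventually_finite_subsets_at_top P_def using F0 by blast
    moreover have "dist (?s F) (?s F') < d" if "P F" "P F'" for F F'
      using close[OF that(1)] close[OF that(2)] dist_triangle2[of "?s F" "?s F'" "?s F0"] \<open>d > 0\<close>
      by linarith
    ultimately show ?thesis
      by blast
  qed
  then have "cauchy_filter (filtermap ?s (finite_subsets_at_top I))"
    by (simp add: cauchy_filter_metric_filtermap)
  moreover have "complete (UNIV::'a set)"
    by (meson Cauchy_convergent UNIV_I complete_def convergent_def)
  ultimately obtain y where "(?s \<longlongrightarrow> y) (finite_subsets_at_top I)"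
    using complete_uniform[where S=UNIV] by (force simp add: filterlim_def)
  then show ?thesis
    using summable_on_def has_sum_def by blast
qed

lemma Bessel_summable:
  fixes e :: "'i \<Rightarrow> 'a::chilbert_space"
  assumes "orthonormal_family I e"
  shows "(\<lambda>i. (cmod (cinner (e i) x))\<^sup>2) summable_on I"
proof (rule nonneg_bdd_above_summable_on)
  have "(\<Sum>i\<in>F. (cmod (cinner (e i) x))\<^sup>2) \<le> (norm x)\<^sup>2" if F: "finite F" "F \<subseteq> I" for F
  proof -
    define y where "y = (\<Sum>i\<in>F. cinner (e i) x *\<^sub>C e i)"
    let ?S = "\<Sum>i\<in>F. (cmod (cinner (e i) x))\<^sup>2"
    have ny: "(norm y)\<^sup>2 = ?S"
      unfolding y_def by (rule orthonormal_norm_sum[OF assms F])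
    have "cinner y x = complex_of_real ?S"
      unfolding y_def by (simp add: cinner_sum_left cinner_scaleC_left complex_norm_square mult.commute del: of_real_power)
    then have "?S \<le> norm y * norm x"
      by (metis Re_cinner Re_complex_of_real norm_cauchy_schwarz)
    also have "\<dots> = sqrt ?S * norm x"
      using ny by (metis norm_ge_zero real_sqrt_unique)
    finally have "sqrt ?S * sqrt ?S \<le> sqrt ?S * norm x"
      by (simp add: sum_nonneg)
    then have "sqrt ?S \<le> norm x"
      by (metis mult_le_cancel_left_pos norm_ge_zero order_le_less real_sqrt_ge_zero sum_nonneg zero_le_power2)
    then show ?thesis
      using real_sqrt_le_iff[of ?S "(norm x)\<^sup>2"] by simp
  qed
  then show "bdd_above (sum (\<lambda>i. (cmod (cinner (e i) x))\<^sup>2) ` {F. F \<subseteq> I \<and> finite F})"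
    by (intro bdd_aboveI2[where M = "(norm x)\<^sup>2"]) auto
qed simp

lemma orthonormal_coefficient:
  fixes e :: "'i \<Rightarrow> 'a::chilbert_space"
  assumes on: "orthonormal_family I e" and s: "((\<lambda>i. c i *\<^sub>C e i) has_sum y) I" and "j \<in> I"
  shows "cinner (e j) y = c j"
proof -
  have "((\<lambda>i. cinner (e j) (c i *\<^sub>C e i)) has_sum cinner (e j) y) I"
    by (rule has_sum_bounded_linear[OF bounded_linear_cinner_right s])
  moreover have "((\<lambda>i. cinner (e j) (c i *\<^sub>C e i)) has_sum c j) I
      \<longleftrightarrow> ((\<lambda>i. cinner (e j) (c i *\<^sub>C e i)) has_sum c j) {j}"
    using on \<open>j \<in> I\<close> by (intro has_sum_cong_neutral) (auto simp: orthonormal_family_def cinner_scaleC_right)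
  moreover have "((\<lambda>i. cinner (e j) (c i *\<^sub>C e i)) has_sum c j) {j}"
    using on \<open>j \<in> I\<close> by (intro has_sum_finiteI) (auto simp: orthonormal_family_def cinner_scaleC_right)
  ultimately show ?thesis
    using has_sum_unique by blast
qed

lemma orthonormal_basis_zeroI:
  fixes e :: "'i \<Rightarrow> 'a::chilbert_space"
  assumes B: "orthonormal_basis I e" and z: "\<And>i. i \<in> I \<Longrightarrow> cinner (e i) x = 0"
  shows "x = 0"
proof -
  let ?Z = "{y. cinner y x = 0}"
  have "complex_vector.subspace ?Z"
    unfolding complex_vector.subspace_def by (simp add: cinner_add_left cinner_scaleC_left)
  then have "cspan (e ` I) \<subseteq> ?Z"
    using z by (intro complex_vector.span_minimal) auto
  moreover have "closed ?Z"
    by (intro closed_Collect_eq continuous_on_const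
        bounded_linear.continuous_on[OF bounded_linear_cinner_left] continuous_on_id)
  ultimately have "closure (cspan (e ` I)) \<subseteq> ?Z"
    by (rule closure_minimal)
  then have "cinner x x = 0"
    using B by (auto simp: orthonormal_basis_def)
  then show ?thesis
    by (simp add: cinner_self)
qed

lemma orthonormal_basis_expansion:
  fixes e :: "'i \<Rightarrow> 'a::chilbert_space"
  assumes B: "orthonormal_basis I e"
  shows "((\<lambda>i. cinner (e i) x *\<^sub>C e i) has_sum x) I"
proof -
  note on = orthonormal_basis_family[OF B]
  obtain y where y: "((\<lambda>i. cinner (e i) x *\<^sub>C e i) has_sum y) I"
    using orthonormal_summable[OF on Bessel_summable[OF on]] by (auto simp: summable_on_def)
  have "x - y = 0"
    using orthonormal_coefficient[OF on y]
    by (intro orthonormal_basis_zeroI[OF B]) (simp add: cinner_diff_right)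
  then show ?thesis
    using y by simp
qed

lemma Parseval:
  fixes e :: "'i \<Rightarrow> 'a::chilbert_space"
  assumes B: "orthonormal_basis I e"
  shows "((\<lambda>i. (cmod (cinner (e i) x))\<^sup>2) has_sum (norm x)\<^sup>2) I"
proof -
  have "((\<lambda>i. cinner x (cinner (e i) x *\<^sub>C e i)) has_sum cinner x x) I"
    by (rule has_sum_bounded_linear[OF bounded_linear_cinner_right orthonormal_basis_expansion[OF B]])
  then have "((\<lambda>i. Re (cinner x (cinner (e i) x *\<^sub>C e i))) has_sum Re (cinner x x)) I"
    by (rule has_sum_Re)
  moreover have "cinner x (cinner (e i) x *\<^sub>C e i) = complex_of_real ((cmod (cinner (e i) x))\<^sup>2)" for i
    by (metis cinner_commute cinner_scaleC_right complex_norm_square)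
  ultimately show ?thesis
    by (simp add: cinner_self del: of_real_power)
qed

lemma orthonormal_basis_exists: "\<exists>B::'a::chilbert_space set. orthonormal_basis B (\<lambda>x. x)"
proof -
  let ?A = "{B::'a set. orthonormal_family B (\<lambda>x. x)}"
  have "\<Union>C \<in> ?A" if C: "subset.chain ?A C" for C
  proof -
    have "cinner x y = (if x = y then 1 else 0)" if xy: "x \<in> \<Union>C" "y \<in> \<Union>C" for x y
    proof -
      obtain X Y where "X \<in> C" "x \<in> X" "Y \<in> C" "y \<in> Y"
        using xy by blast
      moreover have "X \<subseteq> Y \<or> Y \<subseteq> X"
        using C \<open>X \<in> C\<close> \<open>Y \<in> C\<close> by (simp add: subset_chain_def)
      ultimately obtain Z where "Z \<in> C" "x \<in> Z" "y \<in> Z"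
        by blast
      moreover have "orthonormal_family Z (\<lambda>x. x)"
        using C \<open>Z \<in> C\<close> unfolding subset_chain_def by blast
      ultimately show ?thesis
        unfolding orthonormal_family_def by blast
    qed
    then show ?thesis
      unfolding orthonormal_family_def by blast
  qed
  from subset_Zorn'[of ?A, OF this]
  obtain B :: "'a set" where on: "orthonormal_family B (\<lambda>x. x)"
    and max: "\<And>X. orthonormal_family X (\<lambda>x. x) \<Longrightarrow> B \<subseteq> X \<Longrightarrow> X = B"
    by blast
  have "x \<in> closure (cspan B)" for x
  proof -
    obtain y where y: "((\<lambda>b. cinner b x *\<^sub>C b) has_sum y) B"
      using orthonormal_summable[OF on Bessel_summable[OF on]] by (auto simp: summable_on_def)
    have orth: "cinner b (x - y) = 0" if "b \<in> B" for b
      using orthonormal_coefficient[OF on y that] by (simp add: cinner_diff_right)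
    have "x = y"
    proof (rule ccontr)
      assume "x \<noteq> y"
      define u where "u = (1 / norm (x - y)) *\<^sub>R (x - y)"
      have u1: "cinner u u = 1"
        using \<open>x \<noteq> y\<close> by (simp add: u_def cinner_self)
      have ub: "cinner b u = 0" if "b \<in> B" for b
        unfolding u_def cinner_scaleR_right orth[OF that] by simp
      have ub': "cinner u b = 0" if "b \<in> B" for b
        using ub[OF that] cinner_commute[of u b] by simp
      have "orthonormal_family (insert u B) (\<lambda>x. x)"
        using on u1 ub ub' unfolding orthonormal_family_def by fastforce
      then have "u \<in> B"
        using max by blast
      then show False
        using ub u1 by force
    qed
    have "(sum (\<lambda>b. cinner b x *\<^sub>C b) \<longlongrightarrow> x) (finite_subsets_at_top B)"
      using y \<open>x = y\<close> by (simp add: has_sum_def)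
    moreover have "eventually (\<lambda>F. sum (\<lambda>b. cinner b x *\<^sub>C b) F \<in> closure (cspan B)) (finite_subsets_at_top B)"
    proof (rule eventually_finite_subsets_at_top_weakI)
      fix F assume "finite F" "F \<subseteq> B"
      then have "sum (\<lambda>b. cinner b x *\<^sub>C b) F \<in> cspan B"
        by (intro complex_vector.span_sum complex_vector.span_scale) (auto intro: complex_vector.span_base)
      then show "sum (\<lambda>b. cinner b x *\<^sub>C b) F \<in> closure (cspan B)"
        using closure_subset by blast
    qed
    ultimately show ?thesis
      by (intro Lim_in_closed_set[of "closure (cspan B)" _ "finite_subsets_at_top B"]) auto
  qed
  then have "orthonormal_basis B (\<lambda>x. x)"
    using on by (auto simp: orthonormal_basis_def)
  then show ?thesis ..
qed


section \<open>Bounded operators\<close>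

text \<open>Operators are plain functions, so that equality of operators is equality of functions; the
  algebra of all bounded operators is the set of all \<open>T\<close> with \<open>bounded_clinear T\<close>.\<close>

definition bounded_clinear :: "('a::chilbert_space \<Rightarrow> 'b::chilbert_space) \<Rightarrow> bool"
  where "bounded_clinear T \<longleftrightarrow> bounded_linear T \<and> (\<forall>c x. T (c *\<^sub>C x) = c *\<^sub>C T x)"

definition cadjoint :: "('a::chilbert_space \<Rightarrow> 'b::chilbert_space) \<Rightarrow> 'b \<Rightarrow> 'a"
  where "cadjoint T = (THE S. \<forall>x y. cinner (S y) x = cinner y (T x))"

definition is_projection :: "('a::chilbert_space \<Rightarrow> 'a) \<Rightarrow> bool"
  where "is_projection P \<longleftrightarrow> bounded_clinear P \<and> P \<circ> P = P \<and> cadjoint P = P"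

definition projection_onto :: "'a::chilbert_space set \<Rightarrow> 'a \<Rightarrow> 'a"
  where "projection_onto S = (THE P. is_projection P \<and> range P = S)"

definition operator_le :: "('a::chilbert_space \<Rightarrow> 'a) \<Rightarrow> ('a \<Rightarrow> 'a) \<Rightarrow> bool"
  where "operator_le S T \<longleftrightarrow> (\<forall>x. cinner x (T x - S x) \<in> \<real>\<^sub>\<ge>\<^sub>0)"

lemma bounded_clinear_linear: "bounded_clinear T \<Longrightarrow> bounded_linear T"
  by (simp add: bounded_clinear_def)

lemma bounded_clinear_scaleC: "bounded_clinear T \<Longrightarrow> T (c *\<^sub>C x) = c *\<^sub>C T x"
  by (simp add: bounded_clinear_def)

lemma Riesz_exists:
  fixes T :: "'a::chilbert_space \<Rightarrow> complex"
  assumes T: "bounded_clinear T"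
  shows "\<exists>y. \<forall>x. cinner y x = T x"
proof -
  interpret bounded_linear T
    using T by (rule bounded_clinear_linear)
  obtain B :: "'a set" where B: "orthonormal_basis B (\<lambda>x. x)"
    using orthonormal_basis_exists by blast
  note on = orthonormal_basis_family[OF B]
  obtain K where K: "\<And>x. cmod (T x) \<le> norm x * K" "K > 0"
    using pos_bounded by blast
  have T_smult: "T (c *\<^sub>C x) = c * T x" for c x
    using bounded_clinear_scaleC[OF T] by (simp add: scaleC_complex_def)
  have bound: "(\<Sum>b\<in>F. (cmod (cnj (T b)))\<^sup>2) \<le> K\<^sup>2" if F: "finite F" "F \<subseteq> B" for F
  proof -
    define y where "y = (\<Sum>b\<in>F. cnj (T b) *\<^sub>C b)"
    let ?S = "\<Sum>b\<in>F. (cmod (cnj (T b)))\<^sup>2"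
    have ny: "(norm y)\<^sup>2 = ?S"
      unfolding y_def by (rule orthonormal_norm_sum[OF on F])
    have "T y = complex_of_real ?S"
      unfolding y_def by (simp add: sum T_smult complex_norm_square mult.commute del: of_real_power)
    then have "cmod (T y) = ?S"
      by (simp only: norm_of_real) (simp add: sum_nonneg)
    then have "?S \<le> norm y * K"
      using K(1)[of y] by simp
    then have "norm y * norm y \<le> norm y * K"
      using ny by (simp add: power2_eq_square)
    then have "norm y \<le> K"
      using K(2) by (metis less_imp_le mult_le_cancel_left_pos norm_ge_zero order_le_less)
    then show ?thesis
      using ny by (metis norm_ge_zero power_mono)
  qed
  have "(\<lambda>b. (cmod (cnj (T b)))\<^sup>2) summable_on B"
    using bound by (intro nonneg_bdd_above_summable_on bdd_aboveI2[where M = "K\<^sup>2"]) auto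
  from orthonormal_summable[OF on this]
  obtain y where y: "((\<lambda>b. cnj (T b) *\<^sub>C b) has_sum y) B"
    unfolding summable_on_def by blast
  have "cinner y x = T x" for x
  proof -
    have "((\<lambda>b. cinner b x *\<^sub>C b) has_sum x) B"
      by (rule orthonormal_basis_expansion[OF B])
    note e = has_sum_bounded_linear[OF bounded_linear_axioms this]
      has_sum_bounded_linear[OF bounded_linear_cinner_left[of x] y]
    show ?thesis
      using e by (simp add: T_smult cinner_scaleC_left mult.commute has_sum_unique)
  qed
  then show ?thesis
    by blast
qed

lemma cadjoint_eqI:
  fixes T :: "'a::chilbert_space \<Rightarrow> 'b::chilbert_space"
  assumes "\<And>x y. cinner (S y) x = cinner y (T x)"
  shows "cadjoint T = S"
  unfolding cadjoint_def
proof (rule the_equality)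
  fix S' assume S': "\<forall>x y. cinner (S' y) x = cinner y (T x)"
  show "S' = S"
  proof
    show "S' y = S y" for y
      by (rule cinner_eqI) (simp add: S' assms)
  qed
qed (simp add: assms)

lemma cinner_cadjoint:
  fixes T :: "'a::chilbert_space \<Rightarrow> 'b::chilbert_space"
  assumes T: "bounded_clinear T"
  shows "cinner (cadjoint T y) x = cinner y (T x)"
proof -
  have "bounded_clinear (\<lambda>x. cinner y (T x))" for y
    using bounded_linear_compose[OF bounded_linear_cinner_right bounded_clinear_linear[OF T]]
    by (simp add: bounded_clinear_def bounded_clinear_scaleC[OF T] cinner_scaleC_right scaleC_complex_def)
  then have "\<forall>y. \<exists>z. \<forall>x. cinner z x = cinner y (T x)"
    using Riesz_exists by blast
  then obtain S where "\<And>x y. cinner (S y) x = cinner y (T x)"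
    by metis
  then show ?thesis
    using cadjoint_eqI[of S T] by simp
qed

lemma cinner_cadjoint_right:
  fixes T :: "'a::chilbert_space \<Rightarrow> 'b::chilbert_space"
  assumes T: "bounded_clinear T"
  shows "cinner x (cadjoint T y) = cinner (T x) y"
proof -
  have "cinner x (cadjoint T y) = cnj (cinner (cadjoint T y) x)"
    by (rule cinner_commute)
  also have "\<dots> = cnj (cinner y (T x))"
    by (simp only: cinner_cadjoint[OF T])
  also have "\<dots> = cinner (T x) y"
    by (rule cinner_commute[symmetric])
  finally show ?thesis .
qed

lemma bounded_clinear_cadjoint:
  fixes T :: "'a::chilbert_space \<Rightarrow> 'b::chilbert_space"
  assumes T: "bounded_clinear T"
  shows "bounded_clinear (cadjoint T)"
proof -
  obtain K where K: "\<And>x. norm (T x) \<le> norm x * K" "K > 0"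
    using bounded_linear.pos_bounded[OF bounded_clinear_linear[OF T]] by blast
  have bd: "norm (cadjoint T y) \<le> norm y * K" for y
  proof -
    let ?z = "cadjoint T y"
    have "norm ?z * norm ?z = cmod (cinner ?z ?z)"
      by (simp add: cinner_self power2_eq_square norm_mult)
    also have "\<dots> = cmod (cinner y (T ?z))"
      by (simp add: cinner_cadjoint[OF T])
    also have "\<dots> \<le> norm y * (norm ?z * K)"
      using cinner_Cauchy_Schwarz[of y "T ?z"] K(1)[of ?z] by (meson mult_left_mono norm_ge_zero order_trans)
    finally have "norm ?z * norm ?z \<le> norm ?z * (norm y * K)"
      by (simp add: algebra_simps)
    then show ?thesis
      using K(2) by (cases "?z = 0") auto
  qed
  have cs: "cadjoint T (c *\<^sub>C y) = c *\<^sub>C cadjoint T y" for c y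
    by (rule cinner_eqI) (simp add: cinner_cadjoint[OF T] cinner_scaleC_left)
  have "bounded_linear (cadjoint T)"
  proof (rule bounded_linear_intro[where K = K])
    show "cadjoint T (x + y) = cadjoint T x + cadjoint T y" for x y
      by (rule cinner_eqI) (simp add: cinner_cadjoint[OF T] cinner_add_left)
    show "cadjoint T (r *\<^sub>R x) = r *\<^sub>R cadjoint T x" for r x
      using cs[of "complex_of_real r" x] by (simp add: scaleC_of_real)
  qed (rule bd)
  then show ?thesis
    using cs by (simp add: bounded_clinear_def)
qed

lemma cadjoint_cadjoint:
  fixes T :: "'a::chilbert_space \<Rightarrow> 'b::chilbert_space"
  assumes T: "bounded_clinear T"
  shows "cadjoint (cadjoint T) = T"
  by (rule cadjoint_eqI) (simp add: cinner_cadjoint_right[OF T])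

lemma bounded_clinear_comp:
  assumes "bounded_clinear S" "bounded_clinear T"
  shows "bounded_clinear (S \<circ> T)"
  using assms bounded_linear_compose[of S T] by (simp add: bounded_clinear_def o_def)

lemma bounded_clinear_zero: "bounded_clinear (\<lambda>_. 0)"
  by (simp add: bounded_clinear_def)

lemma bounded_clinear_add:
  assumes "bounded_clinear S" "bounded_clinear T"
  shows "bounded_clinear (\<lambda>x. S x + T x)"
  using assms bounded_linear_add[of S T] by (simp add: bounded_clinear_def scaleC_add_right)

lemma bounded_clinear_scale:
  assumes "bounded_clinear T"
  shows "bounded_clinear (\<lambda>x. c *\<^sub>C T x)"
  using assms bounded_linear_compose[OF bounded_linear_scaleC_right[of c], of T]
  by (simp add: bounded_clinear_def scaleC_scaleC mult.commute)

lemma is_projection_eq: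
  assumes P: "is_projection P" and Q: "is_projection Q" and r: "range P = range Q"
  shows "P = Q"
proof
  fix x
  have PP: "P (P y) = P y" and QQ: "Q (Q y) = Q y" for y
    using P Q by (metis comp_apply is_projection_def)+
  have PQ: "P (Q y) = Q y" and QP: "Q (P y) = P y" for y
    using PP QQ r by (metis rangeE rangeI)+
  show "P x = Q x"
  proof (rule cinner_eqI)
    fix z
    have sP: "cinner (P u) v = cinner u (P v)" and sQ: "cinner (Q u) v = cinner u (Q v)" for u v
      using P Q cinner_cadjoint[of P u v] cinner_cadjoint[of Q u v] by (auto simp: is_projection_def)
    show "cinner (P x) z = cinner (Q x) z"
      using sP sQ PQ QP by metis
  qed
qed

lemma projection_onto_line:
  fixes e :: "'a::chilbert_space"
  assumes e: "cinner e e = 1"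
  shows "projection_onto (cspan {e}) = (\<lambda>x. cinner e x *\<^sub>C e)"
proof -
  let ?P = "\<lambda>x. cinner e x *\<^sub>C e"
  have lin: "bounded_linear ?P"
  proof (rule bounded_linear_intro[where K = "norm e * norm e"])
    show "?P (r *\<^sub>R x) = r *\<^sub>R ?P x" for r x
      by (simp only: cinner_scaleR_right scaleR_conv_of_real[of r "cinner e x"]
          scaleC_scaleC[symmetric] scaleC_of_real)
    show "norm (?P x) \<le> norm x * (norm e * norm e)" for x
      using mult_right_mono[OF cinner_Cauchy_Schwarz[of e x], of "norm e"]
      by (simp add: norm_scaleC algebra_simps)
  qed (simp add: cinner_add_right scaleC_add_left)
  have "cadjoint ?P = ?P"
    by (rule cadjoint_eqI)
      (simp add: cinner_scaleC_left cinner_scaleC_right cinner_commute[of _ e, symmetric])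
  then have proj: "is_projection ?P"
    using lin e by (auto simp: is_projection_def bounded_clinear_def cinner_scaleC_right scaleC_scaleC fun_eq_iff)
  have "cspan {e} = range (\<lambda>c. c *\<^sub>C e)"
    by (rule complex_vector.span_singleton)
  moreover have "c *\<^sub>C e \<in> range ?P" for c
    by (rule range_eqI[where x = "c *\<^sub>C e"]) (simp only: cinner_scaleC_right e mult_1_right)
  ultimately have range: "range ?P = cspan {e}"
    by auto
  show ?thesis
    unfolding projection_onto_def
  proof (rule the_equality)
    fix P assume "is_projection P \<and> range P = cspan {e}"
    then show "P = ?P"
      using is_projection_eq[OF _ proj, of P] range by simp
  qed (use proj range in simp)
qed


section \<open>The Hilbert space of Hilbert--Schmidt operators\<close>

definition hilbert_schmidt :: "('a::chilbert_space \<Rightarrow> 'a) \<Rightarrow> bool"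
  where "hilbert_schmidt T \<longleftrightarrow> bounded_clinear T \<and>
    (\<exists>(I::'a set) e. orthonormal_basis I e \<and> (\<lambda>i. (norm (T (e i)))\<^sup>2) summable_on I)"

definition some_basis :: "'a::chilbert_space set"
  where "some_basis = (SOME B. orthonormal_basis B (\<lambda>x. x))"

lemma orthonormal_some_basis: "orthonormal_basis (some_basis :: 'a::chilbert_space set) (\<lambda>x. x)"
  unfolding some_basis_def using orthonormal_basis_exists by (rule someI_ex)

lemma hilbert_schmidt_cadjoint_bound:
  fixes T :: "'a::chilbert_space \<Rightarrow> 'b::chilbert_space"
  assumes T: "bounded_clinear T" and e: "orthonormal_basis I e" and f: "orthonormal_basis K f"
    and s: "(\<lambda>i. (norm (T (e i)))\<^sup>2) summable_on I"
  shows "(\<lambda>k. (norm (cadjoint T (f k)))\<^sup>2) summable_on K"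
    and "(\<Sum>\<^sub>\<infinity>k\<in>K. (norm (cadjoint T (f k)))\<^sup>2) \<le> (\<Sum>\<^sub>\<infinity>i\<in>I. (norm (T (e i)))\<^sup>2)"
proof -
  let ?S = "\<Sum>\<^sub>\<infinity>i\<in>I. (norm (T (e i)))\<^sup>2"
  have bound: "(\<Sum>k\<in>F. (norm (cadjoint T (f k)))\<^sup>2) \<le> ?S" if F: "finite F" "F \<subseteq> K" for F
  proof -
    have "((\<lambda>i. (cmod (cinner (e i) (cadjoint T (f k))))\<^sup>2) has_sum (norm (cadjoint T (f k)))\<^sup>2) I" for k
      by (rule Parseval[OF e])
    moreover have "cmod (cinner (e i) (cadjoint T (f k))) = cmod (cinner (f k) (T (e i)))" for i k
      by (simp add: cinner_cadjoint_right[OF T] cmod_cinner_commute)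
    ultimately have "((\<lambda>i. (cmod (cinner (f k) (T (e i))))\<^sup>2) has_sum (norm (cadjoint T (f k)))\<^sup>2) I" for k
      by (simp only:)
    note pars = this
    have "((\<lambda>i. \<Sum>k\<in>F. (cmod (cinner (f k) (T (e i))))\<^sup>2) has_sum
        (\<Sum>k\<in>F. (norm (cadjoint T (f k)))\<^sup>2)) I"
      using F(1) by (induction F rule: finite_induct) (simp_all add: has_sum_add pars)
    moreover have "(\<Sum>k\<in>F. (cmod (cinner (f k) (T (e i))))\<^sup>2) \<le> (norm (T (e i)))\<^sup>2" for i
      using F by (intro finite_sum_le_has_sum[OF Parseval[OF f]]) auto
    ultimately show ?thesis
      using has_sum_mono[OF _ has_sum_infsum[OF s]] by blast
  qed
  show *: "(\<lambda>k. (norm (cadjoint T (f k)))\<^sup>2) summable_on K"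
    using bound by (intro nonneg_bdd_above_summable_on bdd_aboveI2[where M = ?S]) auto
  show "(\<Sum>\<^sub>\<infinity>k\<in>K. (norm (cadjoint T (f k)))\<^sup>2) \<le> ?S"
    using bound by (intro infsum_le_finite_sums[OF *])
qed

lemma hilbert_schmidt_basis_independent:
  fixes T :: "'a::chilbert_space \<Rightarrow> 'a"
  assumes T: "hilbert_schmidt T" and f: "orthonormal_basis K f"
  shows "(\<lambda>k. (norm (T (f k)))\<^sup>2) summable_on K"
proof -
  obtain I :: "'a set" and e where lin: "bounded_clinear T" and e: "orthonormal_basis I e"
    and s: "(\<lambda>i. (norm (T (e i)))\<^sup>2) summable_on I"
    using T by (auto simp: hilbert_schmidt_def)
  have "(\<lambda>i. (norm (cadjoint T (e i)))\<^sup>2) summable_on I"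
    by (rule hilbert_schmidt_cadjoint_bound(1)[OF lin e e s])
  from hilbert_schmidt_cadjoint_bound(1)[OF bounded_clinear_cadjoint[OF lin] e f this]
  show ?thesis
    by (simp add: cadjoint_cadjoint[OF lin])
qed

lemma hilbert_schmidt_iff:
  "hilbert_schmidt T \<longleftrightarrow> bounded_clinear T \<and> (\<lambda>b. (norm (T b))\<^sup>2) summable_on some_basis"
  using hilbert_schmidt_basis_independent[OF _ orthonormal_some_basis, of T] orthonormal_some_basis
  by (auto simp: hilbert_schmidt_def)

typedef (overloaded) 'a hs = "{T::'a::chilbert_space \<Rightarrow> 'a. hilbert_schmidt T}"
  morphisms hs_op Abs_hs
proof
  show "(\<lambda>_. 0) \<in> {T::'a \<Rightarrow> 'a. hilbert_schmidt T}"
    by (simp add: hilbert_schmidt_iff bounded_clinear_zero)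
qed

setup_lifting type_definition_hs

lemma summable_on_sq_add:
  fixes f g :: "'i \<Rightarrow> 'a::real_normed_vector"
  assumes "(\<lambda>i. (norm (f i))\<^sup>2) summable_on I" "(\<lambda>i. (norm (g i))\<^sup>2) summable_on I"
  shows "(\<lambda>i. (norm (f i + g i))\<^sup>2) summable_on I"
proof (rule summable_on_comparison_test)
  show "(\<lambda>i. 2 * (norm (f i))\<^sup>2 + 2 * (norm (g i))\<^sup>2) summable_on I"
    using assms by (intro summable_on_add summable_on_cmult_right)
  show "(norm (f i + g i))\<^sup>2 \<le> 2 * (norm (f i))\<^sup>2 + 2 * (norm (g i))\<^sup>2" for i
  proof -
    have "(norm (f i + g i))\<^sup>2 \<le> (norm (f i) + norm (g i))\<^sup>2"
      by (intro power_mono norm_triangle_ineq) simp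
    also have "\<dots> \<le> 2 * (norm (f i))\<^sup>2 + 2 * (norm (g i))\<^sup>2"
      using sum_squares_bound[of "norm (f i)" "norm (g i)"] by (simp add: power2_sum)
    finally show ?thesis .
  qed
qed simp

lemma hilbert_schmidt_add:
  "hilbert_schmidt S \<Longrightarrow> hilbert_schmidt T \<Longrightarrow> hilbert_schmidt (\<lambda>x. S x + T x)"
  by (simp add: hilbert_schmidt_iff bounded_clinear_add summable_on_sq_add)

lemma hilbert_schmidt_scaleC: "hilbert_schmidt T \<Longrightarrow> hilbert_schmidt (\<lambda>x. c *\<^sub>C T x)"
  by (simp add: hilbert_schmidt_iff bounded_clinear_scale norm_scaleC power_mult_distrib summable_on_cmult_right)

lemma hilbert_schmidt_scaleR: "hilbert_schmidt T \<Longrightarrow> hilbert_schmidt (\<lambda>x. r *\<^sub>R T x)"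
  using hilbert_schmidt_scaleC[of T "complex_of_real r"] by (simp add: scaleC_of_real)

lemma hilbert_schmidt_uminus: "hilbert_schmidt T \<Longrightarrow> hilbert_schmidt (\<lambda>x. - T x)"
  using hilbert_schmidt_scaleR[of T "-1"] by simp

lemma hilbert_schmidt_cadjoint: "hilbert_schmidt T \<Longrightarrow> hilbert_schmidt (cadjoint T)"
  using hilbert_schmidt_cadjoint_bound(1)[OF _ orthonormal_some_basis orthonormal_some_basis, of T]
  by (simp add: hilbert_schmidt_iff bounded_clinear_cadjoint)

lemma hilbert_schmidt_left_mult:
  assumes x: "bounded_clinear x" and T: "hilbert_schmidt T"
  shows "hilbert_schmidt (x \<circ> T)"
proof -
  obtain K where K: "\<And>y. norm (x y) \<le> norm y * K" "K > 0"
    using bounded_linear.pos_bounded[OF bounded_clinear_linear[OF x]] by blast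
  have "(\<lambda>b. (norm (x (T b)))\<^sup>2) summable_on some_basis"
  proof (rule summable_on_comparison_test)
    show "(\<lambda>b. (norm (T b))\<^sup>2 * K\<^sup>2) summable_on some_basis"
      using T by (intro summable_on_cmult_left) (simp add: hilbert_schmidt_iff)
    show "(norm (x (T b)))\<^sup>2 \<le> (norm (T b))\<^sup>2 * K\<^sup>2" for b
      using power_mono[OF K(1)[of "T b"], of 2] by (simp add: power_mult_distrib)
  qed simp
  then show ?thesis
    using x T by (simp add: hilbert_schmidt_iff bounded_clinear_comp)
qed

instantiation hs :: (chilbert_space) real_vector
begin

lift_definition zero_hs :: "'a hs" is "\<lambda>_. 0"
  by (simp add: hilbert_schmidt_iff bounded_clinear_zero)

lift_definition plus_hs :: "'a hs \<Rightarrow> 'a hs \<Rightarrow> 'a hs" is "\<lambda>S T x. S x + T x"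
  by (rule hilbert_schmidt_add)

lift_definition uminus_hs :: "'a hs \<Rightarrow> 'a hs" is "\<lambda>T x. - T x"
  by (rule hilbert_schmidt_uminus)

lift_definition minus_hs :: "'a hs \<Rightarrow> 'a hs \<Rightarrow> 'a hs" is "\<lambda>S T x. S x - T x"
  using hilbert_schmidt_add[OF _ hilbert_schmidt_uminus] by fastforce

lift_definition scaleR_hs :: "real \<Rightarrow> 'a hs \<Rightarrow> 'a hs" is "\<lambda>r T x. r *\<^sub>R T x"
  by (rule hilbert_schmidt_scaleR)

instance
  by standard (transfer; simp add: algebra_simps)+

end

lemma hs_summable: "(\<lambda>b. (norm (hs_op T b))\<^sup>2) summable_on some_basis"
  using hs_op[of T] by (simp add: hilbert_schmidt_iff)

lemma hs_bounded_clinear: "bounded_clinear (hs_op T)"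
  using hs_op[of T] by (simp add: hilbert_schmidt_iff)

lemma hs_cinner_summable: "(\<lambda>b. cinner (hs_op S b) (hs_op T b)) summable_on some_basis"
proof -
  have "(\<lambda>b. norm (cinner (hs_op S b) (hs_op T b))) summable_on some_basis"
  proof (rule summable_on_comparison_test)
    show "(\<lambda>b. (norm (hs_op S b))\<^sup>2 + (norm (hs_op T b))\<^sup>2) summable_on some_basis"
      by (intro summable_on_add hs_summable)
    show "norm (cinner (hs_op S b) (hs_op T b)) \<le> (norm (hs_op S b))\<^sup>2 + (norm (hs_op T b))\<^sup>2" for b
      using cinner_Cauchy_Schwarz[of "hs_op S b" "hs_op T b"]
        sum_squares_bound[of "norm (hs_op S b)" "norm (hs_op T b)"]
        mult_nonneg_nonneg[OF norm_ge_zero norm_ge_zero, of "hs_op S b" "hs_op T b"]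
      by linarith
  qed simp
  then show ?thesis
    by (rule abs_summable_summable)
qed

text \<open>The inner product below is \<open>tr (S* T)\<close>; its value does not depend on the chosen orthonormal
  basis.\<close>

definition hs_cinner :: "'a::chilbert_space hs \<Rightarrow> 'a hs \<Rightarrow> complex"
  where "hs_cinner S T = (\<Sum>\<^sub>\<infinity>b\<in>some_basis. cinner (hs_op S b) (hs_op T b))"

lemma hs_cinner_add: "hs_cinner S (T + U) = hs_cinner S T + hs_cinner S U"
  unfolding hs_cinner_def plus_hs.rep_eq cinner_add_right
  by (rule infsum_add[OF hs_cinner_summable hs_cinner_summable])

lemma hs_cinner_commute: "hs_cinner S T = cnj (hs_cinner T S)"
  unfolding hs_cinner_def infsum_cnj[symmetric] by (metis cinner_commute)

lemma hs_cinner_scaleR: "hs_cinner S (r *\<^sub>R T) = r *\<^sub>R hs_cinner S T"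
  unfolding hs_cinner_def scaleR_hs.rep_eq cinner_scaleR_right scaleR_conv_of_real
  by (rule infsum_cmult_right')

lemma hs_cinner_self: "hs_cinner T T = complex_of_real (\<Sum>\<^sub>\<infinity>b\<in>some_basis. (norm (hs_op T b))\<^sup>2)"
proof -
  have "((\<lambda>b. complex_of_real ((norm (hs_op T b))\<^sup>2)) has_sum
      complex_of_real (\<Sum>\<^sub>\<infinity>b\<in>some_basis. (norm (hs_op T b))\<^sup>2)) some_basis"
    by (rule has_sum_bounded_linear[OF bounded_linear_of_real has_sum_infsum[OF hs_summable]])
  then show ?thesis
    unfolding hs_cinner_def cinner_self by (rule infsumI)
qed

lemma bounded_clinear_eq_on_basis:
  fixes S :: "'a::chilbert_space \<Rightarrow> 'b::chilbert_space"
  assumes S: "bounded_clinear S" and T: "bounded_clinear T" and B: "orthonormal_basis I e"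
    and eq: "\<And>i. i \<in> I \<Longrightarrow> S (e i) = T (e i)"
  shows "S = T"
proof
  fix x
  note x = orthonormal_basis_expansion[OF B, of x]
  have "((\<lambda>i. S (cinner (e i) x *\<^sub>C e i)) has_sum S x) I"
    by (rule has_sum_bounded_linear[OF bounded_clinear_linear[OF S] x])
  moreover have "((\<lambda>i. T (cinner (e i) x *\<^sub>C e i)) has_sum T x) I"
    by (rule has_sum_bounded_linear[OF bounded_clinear_linear[OF T] x])
  then have "((\<lambda>i. S (cinner (e i) x *\<^sub>C e i)) has_sum T x) I"
    using eq by (simp add: bounded_clinear_scaleC[OF S] bounded_clinear_scaleC[OF T] cong: has_sum_cong)
  ultimately show "S x = T x"
    using has_sum_unique by blast
qed

lemma hs_cinner_self_zero:
  assumes "hs_cinner T T = 0"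
  shows "T = 0"
proof -
  have "hs_op T b = 0" if "b \<in> some_basis" for b
    using nonneg_infsum_le_0D[OF _ hs_summable _ that, of T] assms by (simp add: hs_cinner_self)
  then have "hs_op T = (\<lambda>_. 0)"
    by (intro bounded_clinear_eq_on_basis[OF hs_bounded_clinear bounded_clinear_zero orthonormal_some_basis])
  then show ?thesis
    by (simp add: hs_op_inject[symmetric] zero_hs.rep_eq)
qed

instantiation hs :: (chilbert_space) real_inner
begin

definition inner_hs :: "'a hs \<Rightarrow> 'a hs \<Rightarrow> real"
  where "inner_hs S T = Re (hs_cinner S T)"

definition norm_hs :: "'a hs \<Rightarrow> real"
  where "norm_hs T = sqrt (inner T T)"

definition sgn_hs :: "'a hs \<Rightarrow> 'a hs"
  where "sgn_hs T = T /\<^sub>R norm T"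

definition dist_hs :: "'a hs \<Rightarrow> 'a hs \<Rightarrow> real"
  where "dist_hs S T = norm (S - T)"

definition uniformity_hs :: "('a hs \<times> 'a hs) filter"
  where "uniformity_hs = (INF e\<in>{0<..}. principal {(S, T). dist S T < e})"

definition open_hs :: "'a hs set \<Rightarrow> bool"
  where "open_hs U \<longleftrightarrow> (\<forall>S\<in>U. \<forall>\<^sub>F (S', T) in uniformity. S' = S \<longrightarrow> T \<in> U)"

instance
proof
  fix S T U :: "'a hs" and r :: real
  show comm: "inner S T = inner T S" for S T :: "'a hs"
    unfolding inner_hs_def by (metis hs_cinner_commute cnj.simps(1))
  show "inner (S + T) U = inner S U + inner T U"
    unfolding comm[of _ U] by (simp add: inner_hs_def hs_cinner_add)
  show "inner (r *\<^sub>R S) T = r * inner S T"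
    unfolding comm[of _ T] by (simp add: inner_hs_def hs_cinner_scaleR)
  show "0 \<le> inner S S"
    by (simp add: inner_hs_def hs_cinner_self infsum_nonneg)
  show "inner S S = 0 \<longleftrightarrow> S = 0"
  proof
    assume "inner S S = 0"
    then have "hs_cinner S S = 0"
      by (simp add: inner_hs_def hs_cinner_self)
    then show "S = 0"
      by (rule hs_cinner_self_zero)
  qed (use hs_cinner_scaleR[of S 0 0] in \<open>simp add: inner_hs_def\<close>)
qed (simp_all add: norm_hs_def sgn_hs_def dist_hs_def uniformity_hs_def open_hs_def)

end

lemma norm_hs_sq: "(norm T)\<^sup>2 = (\<Sum>\<^sub>\<infinity>b\<in>some_basis. (norm (hs_op T b))\<^sup>2)"
  by (simp add: norm_hs_def inner_hs_def hs_cinner_self infsum_nonneg)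

lemma norm_hs_op_le: "norm (hs_op T x) \<le> norm T * norm x"
proof -
  have bound: "norm (cadjoint S y) \<le> sqrt (\<Sum>\<^sub>\<infinity>b\<in>some_basis. (norm (S b))\<^sup>2) * norm y"
    if S: "hilbert_schmidt S" for S :: "'a \<Rightarrow> 'a" and y
  proof -
    have lin: "bounded_clinear S" and s: "(\<lambda>b. (norm (S b))\<^sup>2) summable_on some_basis"
      using S by (auto simp: hilbert_schmidt_iff)
    have "(norm (cadjoint S y))\<^sup>2 \<le> (\<Sum>\<^sub>\<infinity>b\<in>some_basis. (norm (S b))\<^sup>2) * (norm y)\<^sup>2"
    proof (rule has_sum_mono[OF Parseval[OF orthonormal_some_basis]])
      show "((\<lambda>b. (norm (S b))\<^sup>2 * (norm y)\<^sup>2) has_sum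
          (\<Sum>\<^sub>\<infinity>b\<in>some_basis. (norm (S b))\<^sup>2) * (norm y)\<^sup>2) some_basis"
        by (intro has_sum_cmult_left has_sum_infsum s)
      show "(cmod (cinner b (cadjoint S y)))\<^sup>2 \<le> (norm (S b))\<^sup>2 * (norm y)\<^sup>2" for b
        using power_mono[OF cinner_Cauchy_Schwarz[of "S b" y], of 2]
        by (simp add: cinner_cadjoint_right[OF lin] power_mult_distrib)
    qed
    then have "sqrt ((norm (cadjoint S y))\<^sup>2) \<le> sqrt ((\<Sum>\<^sub>\<infinity>b\<in>some_basis. (norm (S b))\<^sup>2) * (norm y)\<^sup>2)"
      by (rule real_sqrt_le_mono)
    then show ?thesis
      by (simp add: real_sqrt_mult)
  qed
  have T: "hilbert_schmidt (hs_op T)"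
    using hs_op[of T] by simp
  have "norm (hs_op T x) = norm (cadjoint (cadjoint (hs_op T)) x)"
    by (simp add: cadjoint_cadjoint[OF hs_bounded_clinear])
  also have "\<dots> \<le> sqrt (\<Sum>\<^sub>\<infinity>b\<in>some_basis. (norm (cadjoint (hs_op T) b))\<^sup>2) * norm x"
    by (rule bound[OF hilbert_schmidt_cadjoint[OF T]])
  also have "(\<Sum>\<^sub>\<infinity>b\<in>some_basis. (norm (cadjoint (hs_op T) b))\<^sup>2) \<le> (norm T)\<^sup>2"
    unfolding norm_hs_sq
    by (rule hilbert_schmidt_cadjoint_bound(2)[OF hs_bounded_clinear orthonormal_some_basis
          orthonormal_some_basis hs_summable])
  finally show ?thesis
    by (simp add: mult_right_mono)
qed

instance hs :: (chilbert_space) complete_space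
proof
  fix X :: "nat \<Rightarrow> 'a hs"
  assume X: "Cauchy X"
  have diff: "hs_op (X n) x - hs_op (X m) x = hs_op (X n - X m) x" for n m x
    by (simp add: minus_hs.rep_eq)
  have "Cauchy (\<lambda>n. hs_op (X n) x)" for x
  proof (rule CauchyI)
    fix d :: real assume "d > 0"
    then have "d / (norm x + 1) > 0"
      by (simp add: add_nonneg_pos)
    then obtain N where N: "\<And>m n. m \<ge> N \<Longrightarrow> n \<ge> N \<Longrightarrow> norm (X m - X n) < d / (norm x + 1)"
      using CauchyD[OF X] by metis
    have "norm (hs_op (X m) x - hs_op (X n) x) < d" if "m \<ge> N" "n \<ge> N" for m n
    proof -
      have "norm (hs_op (X m - X n) x) \<le> norm (X m - X n) * norm x"
        by (rule norm_hs_op_le)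
      also have "\<dots> \<le> norm (X m - X n) * (norm x + 1)"
        by (intro mult_left_mono) auto
      also have "\<dots> < d"
        using N[OF that] by (simp add: pos_less_divide_eq add_nonneg_pos)
      finally show ?thesis
        by (simp add: diff)
    qed
    then show "\<exists>M. \<forall>m\<ge>M. \<forall>n\<ge>M. norm (hs_op (X m) x - hs_op (X n) x) < d"
      by blast
  qed
  then have "\<forall>x. \<exists>y. (\<lambda>n. hs_op (X n) x) \<longlonglongrightarrow> y"
    by (meson Cauchy_convergent convergent_def)
  then obtain f where f: "\<And>x. (\<lambda>n. hs_op (X n) x) \<longlonglongrightarrow> f x"
    by metis
  obtain M where M: "\<And>n. norm (X n) \<le> M"
    using Cauchy_Bseq[OF X] by (auto simp: Bseq_def)
  note lin = bounded_clinear_linear[OF hs_bounded_clinear]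
  have fc: "f (c *\<^sub>C x) = c *\<^sub>C f x" for c x
    using LIMSEQ_unique[OF f[of "c *\<^sub>C x"]]
      bounded_linear.tendsto[OF bounded_linear_scaleC_right f[of x], of c]
    by (simp add: bounded_clinear_scaleC[OF hs_bounded_clinear])
  have "bounded_linear f"
  proof (rule bounded_linear_intro[where K = M])
    show "f (x + y) = f x + f y" for x y
      using LIMSEQ_unique[OF f[of "x + y"]] tendsto_add[OF f[of x] f[of y]]
      by (simp add: linear_add[OF bounded_linear.linear[OF lin]])
    show "f (r *\<^sub>R x) = r *\<^sub>R f x" for r x
      using fc[of "complex_of_real r" x] by (simp add: scaleC_of_real)
    show "norm (f x) \<le> norm x * M" for x
    proof (rule LIMSEQ_le_const2[OF tendsto_norm[OF f[of x]]])
      have "norm (hs_op (X n) x) \<le> norm x * M" for n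
        using norm_hs_op_le[of "X n" x] mult_right_mono[OF M[of n] norm_ge_zero[of x]]
        by (simp add: mult.commute)
      then show "\<exists>N. \<forall>n\<ge>N. norm (hs_op (X n) x) \<le> norm x * M"
        by blast
    qed
  qed
  then have flin: "bounded_clinear f"
    using fc by (simp add: bounded_clinear_def)
  have tail: "(\<Sum>b\<in>F. (norm (hs_op (X n) b - f b))\<^sup>2) \<le> d\<^sup>2"
    if F: "finite F" "F \<subseteq> some_basis" and N: "\<And>m. m \<ge> N \<Longrightarrow> norm (X n - X m) \<le> d" for F n N d
  proof (rule LIMSEQ_le_const2)
    show "(\<lambda>m. \<Sum>b\<in>F. (norm (hs_op (X n) b - hs_op (X m) b))\<^sup>2)
        \<longlonglongrightarrow> (\<Sum>b\<in>F. (norm (hs_op (X n) b - f b))\<^sup>2)"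
      by (intro tendsto_sum tendsto_power tendsto_norm tendsto_diff tendsto_const f)
    have "(\<Sum>b\<in>F. (norm (hs_op (X n) b - hs_op (X m) b))\<^sup>2) \<le> d\<^sup>2" if "m \<ge> N" for m
    proof -
      have "(\<Sum>b\<in>F. (norm (hs_op (X n - X m) b))\<^sup>2) \<le> (norm (X n - X m))\<^sup>2"
        unfolding norm_hs_sq using F by (intro finite_sum_le_infsum hs_summable) auto
      also have "\<dots> \<le> d\<^sup>2"
        by (intro power_mono N that) simp
      finally show ?thesis
        by (simp add: diff)
    qed
    then show "\<exists>N. \<forall>m\<ge>N. (\<Sum>b\<in>F. (norm (hs_op (X n) b - hs_op (X m) b))\<^sup>2) \<le> d\<^sup>2"
      by blast
  qed
  have "(\<lambda>b. (norm (hs_op (X 0) b - f b))\<^sup>2) summable_on some_basis"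
  proof (rule nonneg_bdd_above_summable_on)
    have "norm (X 0 - X m) \<le> 2 * M" for m
      using norm_triangle_ineq4[of "X 0" "X m"] M[of 0] M[of m] by linarith
    then show "bdd_above (sum (\<lambda>b. (norm (hs_op (X 0) b - f b))\<^sup>2) ` {F. F \<subseteq> some_basis \<and> finite F})"
      using tail[of _ 0 0 "2 * M"] by (intro bdd_aboveI2[where M = "(2 * M)\<^sup>2"]) auto
  qed simp
  then have "(\<lambda>b. (norm (f b - hs_op (X 0) b))\<^sup>2) summable_on some_basis"
    by (simp add: norm_minus_commute)
  from summable_on_sq_add[OF this hs_summable[of "X 0"]]
  have "hilbert_schmidt f"
    using flin by (simp add: hilbert_schmidt_iff)
  then obtain L where L: "hs_op L = f"
    using Abs_hs_inverse[of f] by blast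
  have "X \<longlonglongrightarrow> L"
  proof (rule LIMSEQ_I)
    fix d :: real assume "d > 0"
    then obtain N where N: "\<And>m n. m \<ge> N \<Longrightarrow> n \<ge> N \<Longrightarrow> norm (X m - X n) < d / 2"
      using CauchyD[OF X, of "d / 2"] by auto
    have "norm (X n - L) < d" if "n \<ge> N" for n
    proof -
      have "(norm (X n - L))\<^sup>2 \<le> (d / 2)\<^sup>2"
        unfolding norm_hs_sq
      proof (rule infsum_le_finite_sums[OF hs_summable])
        fix F :: "'a set" assume "finite F" "F \<subseteq> some_basis"
        then show "(\<Sum>b\<in>F. (norm (hs_op (X n - L) b))\<^sup>2) \<le> (d / 2)\<^sup>2"
          using tail[of F N n "d / 2"] N[OF that] by (auto simp: minus_hs.rep_eq L intro: less_imp_le)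
      qed
      then have "norm (X n - L) \<le> d / 2"
        by (rule power2_le_imp_le) (use \<open>d > 0\<close> in linarith)
      then show ?thesis
        using \<open>d > 0\<close> by linarith
    qed
    then show "\<exists>N. \<forall>n\<ge>N. norm (X n - L) < d"
      by blast
  qed
  then show "convergent X"
    by (auto simp: convergent_def)
qed

instantiation hs :: (chilbert_space) chilbert_space
begin

lift_definition scaleC_hs :: "complex \<Rightarrow> 'a hs \<Rightarrow> 'a hs" is "\<lambda>c T x. c *\<^sub>C T x"
  by (rule hilbert_schmidt_scaleC)

definition cinner_hs :: "'a hs \<Rightarrow> 'a hs \<Rightarrow> complex"
  where "cinner_hs S T = hs_cinner S T"

instance
proof
  fix S T U :: "'a hs" and c d :: complex and r :: real
  show "c *\<^sub>C (S + T) = c *\<^sub>C S + c *\<^sub>C T"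
    by transfer (simp add: scaleC_add_right)
  show "(c + d) *\<^sub>C S = c *\<^sub>C S + d *\<^sub>C S"
    by transfer (simp add: scaleC_add_left)
  show "c *\<^sub>C d *\<^sub>C S = (c * d) *\<^sub>C S"
    by transfer (simp add: scaleC_scaleC)
  show "complex_of_real r *\<^sub>C S = r *\<^sub>R S"
    by transfer (simp add: scaleC_of_real)
  show "cinner S T = cnj (cinner T S)"
    unfolding cinner_hs_def by (rule hs_cinner_commute)
  show "cinner S (T + U) = cinner S T + cinner S U"
    unfolding cinner_hs_def by (rule hs_cinner_add)
  show "cinner S (c *\<^sub>C T) = c * cinner S T"
    unfolding cinner_hs_def hs_cinner_def scaleC_hs.rep_eq cinner_scaleC_right
    by (rule infsum_cmult_right')
  show "Re (cinner S T) = inner S T"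
    by (simp add: cinner_hs_def inner_hs_def)
qed

end


section \<open>The standard representation\<close>

text \<open>The von Neumann tensor product of the algebra of bounded operators with its commutant is
  identified with the algebra of all bounded operators on \<^typ>\<open>'a hs\<close>; under this identification
  the elementary tensor of \<open>x\<close> and \<open>y'\<close> is the product of left multiplication by \<open>x\<close> with \<open>y'\<close>, where
  \<open>y'\<close> is an element of the commutant, itself an operator on \<^typ>\<open>'a hs\<close>.\<close>

definition left_mult :: "('a::chilbert_space \<Rightarrow> 'a) \<Rightarrow> 'a hs \<Rightarrow> 'a hs"
  where "left_mult x \<rho> = Abs_hs (x \<circ> hs_op \<rho>)"

lemma hs_op_left_mult: "bounded_clinear x \<Longrightarrow> hs_op (left_mult x \<rho>) = x \<circ> hs_op \<rho>"
  using hilbert_schmidt_left_mult[of x "hs_op \<rho>"] hs_op[of \<rho>]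
  by (simp add: left_mult_def Abs_hs_inverse)

lift_definition modular_conj :: "'a::chilbert_space hs \<Rightarrow> 'a hs" is cadjoint
  by (rule hilbert_schmidt_cadjoint)

lemma hs_op_right_mult:
  assumes x: "bounded_clinear x"
  shows "hs_op ((modular_conj \<circ> left_mult (cadjoint x) \<circ> modular_conj) \<rho>) = hs_op \<rho> \<circ> x"
  by (simp add: modular_conj.rep_eq hs_op_left_mult bounded_clinear_cadjoint x)
    (rule cadjoint_eqI, simp add: cinner_cadjoint_right hs_bounded_clinear x)

definition tensor :: "('a::chilbert_space \<Rightarrow> 'a) \<Rightarrow> ('a hs \<Rightarrow> 'a hs) \<Rightarrow> 'a hs \<Rightarrow> 'a hs"
  where "tensor x y' = left_mult x \<circ> y'"

definition diagonal_projection :: "('a::chilbert_space hs \<Rightarrow> 'a hs) \<Rightarrow> bool"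
  where "diagonal_projection p \<longleftrightarrow> is_projection p \<and>
    (\<forall>x. bounded_clinear x \<longrightarrow>
      p \<circ> tensor x id \<circ> p = p \<circ> tensor id (modular_conj \<circ> left_mult (cadjoint x) \<circ> modular_conj) \<circ> p)"

definition maximal_diagonal_projection :: "('a::chilbert_space hs \<Rightarrow> 'a hs) \<Rightarrow> bool"
  where "maximal_diagonal_projection p \<longleftrightarrow> diagonal_projection p \<and>
    (\<forall>q. diagonal_projection q \<and> operator_le p q \<longrightarrow> q = p)"

text \<open>Topology defined by the seminorms \<open>T \<mapsto> (\<Sum>n. \<parallel>T (\<xi> n)\<parallel>\<^sup>2)\<^sup>1\<^sup>/\<^sup>2\<close>, for all square-summable
  sequences \<open>\<xi>\<close>, on the set of bounded operators.\<close>

definition sigma_strong_topology :: "('a::chilbert_space \<Rightarrow> 'a) topology"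
  where "sigma_strong_topology = topology_generated_by
    {{T. bounded_clinear T \<and> sqrt (\<Sum>n. (norm (T (\<xi> n) - S (\<xi> n)))\<^sup>2) < \<epsilon>} | S (\<xi> :: nat \<Rightarrow> 'a) \<epsilon>.
      bounded_clinear S \<and> summable (\<lambda>n. (norm (\<xi> n))\<^sup>2) \<and> \<epsilon> > 0}"

end

theory Submission
  imports Defs
begin

text \<open>Let \<open>K\<close> be the range of a projection \<open>p\<close>. Testing on rank-one operators, \<open>p\<close> is diagonal only if
  \<open>\<rho> \<sigma>\<^sup>* = \<sigma>\<^sup>* \<rho>\<close> for all \<open>\<rho>, \<sigma> \<in> K\<close>. If \<open>K\<close> contains all \<open>|e\<^sub>i\<rangle>\<langle>e\<^sub>i|\<close> of an orthonormal basis, this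
  forces every element of \<open>K\<close> to be diagonal in that basis, whence the maximality in (b). Conversely,
  the elements of \<open>K\<close> are normal and compact, and the eigenspaces of each of them are invariant under
  all the others and their adjoints, even without Fuglede's theorem. So they have a joint eigenvector
  in every nonzero closed invariant subspace, and a maximal orthonormal set of joint eigenvectors is a
  basis whose diagonal operators contain \<open>K\<close>; by maximality of \<open>p\<close> they are all of \<open>K\<close>.\<close>

section \<open>Orthogonal projections\<close>

lemma is_projectionI:
  assumes "bounded_clinear P" "\<And>x. P (P x) = P x" "\<And>x y. cinner (P x) y = cinner x (P y)"
  shows "is_projection P"
  using assms cadjoint_eqI[of P P] by (auto simp: is_projection_def fun_eq_iff)

lemma
  assumes "is_projection P"
  shows is_projection_bounded: "bounded_clinear P"
    and is_projection_idem: "P (P x) = P x"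
    and is_projection_symmetric: "cinner (P x) y = cinner x (P y)"
  using assms cinner_cadjoint[of P x y] by (auto simp: is_projection_def fun_eq_iff)

lemma is_projection_range_iff: "is_projection P \<Longrightarrow> x \<in> range P \<longleftrightarrow> P x = x"
  by (metis is_projection_idem rangeE rangeI)

text \<open>Cauchy-Schwarz with one factor \<open>norm y\<close> cancelled. With
  \<open>y = P x\<close> it makes every projection a contraction.\<close>

lemma norm_le_if_cinner_self:
  assumes "cinner y y = cinner x y"
  shows "norm y \<le> norm x"
proof -
  have "norm y * norm y = cmod (cinner x y)"
    using assms by (metis cinner_self norm_of_real abs_of_nonneg zero_le_power2 power2_eq_square)
  also have "\<dots> \<le> norm x * norm y"
    by (rule cinner_Cauchy_Schwarz)
  finally show ?thesis
    by (metis mult_le_cancel_right_pos norm_ge_zero order_le_less)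
qed

lemma is_projection_norm_le: "is_projection P \<Longrightarrow> norm (P x) \<le> norm x"
  by (rule norm_le_if_cinner_self) (metis is_projection_idem is_projection_symmetric)

text \<open>On \<open>y = P x\<close> the quadratic form of \<open>Q - P\<close> is minus the
  squared norm of \<open>y - Q y\<close>, so positivity forces \<open>Q y = y\<close>. Conversely,
  inclusion of the ranges makes \<open>Q - P\<close> itself a projection, hence positive.\<close>

lemma operator_le_projection_iff:
  assumes P: "is_projection P" and Q: "is_projection Q"
  shows "operator_le P Q \<longleftrightarrow> range P \<subseteq> range Q"
proof
  assume le: "operator_le P Q"
  have "Q (P x) = P x" for x
  proof -
    let ?y = "P x"
    have "cinner ?y (Q ?y - P ?y) \<in> \<real>\<^sub>\<ge>\<^sub>0"
      using le by (simp add: operator_le_def)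
    moreover have "cinner ?y (Q ?y - P ?y) = - cinner (?y - Q ?y) (?y - Q ?y)"
      by (simp add: is_projection_idem[OF P] is_projection_idem[OF Q] cinner_diff_left
          cinner_diff_right is_projection_symmetric[OF Q])
    moreover have "\<dots> = complex_of_real (- (norm (?y - Q ?y))\<^sup>2)"
      by (simp add: cinner_self)
    ultimately show ?thesis
      by (simp only: nonneg_Reals_of_real_iff) simp
  qed
  then show "range P \<subseteq> range Q"
    by (metis image_subsetI rangeI)
next
  assume "range P \<subseteq> range Q"
  then have QP: "Q (P x) = P x" for x
    using is_projection_range_iff[OF Q] by blast
  have PQ: "P (Q x) = P x" for x
    by (rule cinner_eqI) (simp add: is_projection_symmetric[OF P] is_projection_symmetric[OF Q] QP)
  have "cinner x (Q x - P x) = cinner (Q x - P x) (Q x - P x)" for x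
    by (simp add: cinner_diff_left cinner_diff_right is_projection_symmetric[OF P]
        is_projection_symmetric[OF Q] is_projection_idem[OF P] is_projection_idem[OF Q] PQ QP)
  then show "operator_le P Q"
    by (simp add: operator_le_def cinner_self del: of_real_power)
qed

section \<open>Orthonormal families\<close>

text \<open>For an orthonormal family this is the orthogonal projection onto its closed span. With
  the index set as a parameter, the finite partial sums of the expansion are projections of the same
  form.\<close>

definition orthonormal_proj :: "'i set \<Rightarrow> ('i \<Rightarrow> 'a::chilbert_space) \<Rightarrow> 'a \<Rightarrow> 'a"
  where "orthonormal_proj I e x = (\<Sum>\<^sub>\<infinity>i\<in>I. cinner (e i) x *\<^sub>C e i)"

lemma orthonormal_proj_has_sum:
  "orthonormal_family I e \<Longrightarrow>
    ((\<lambda>i. cinner (e i) x *\<^sub>C e i) has_sum orthonormal_proj I e x) I"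
  unfolding orthonormal_proj_def
  by (intro has_sum_infsum orthonormal_summable Bessel_summable)

lemma cinner_orthonormal_proj:
  "orthonormal_family I e \<Longrightarrow> i \<in> I \<Longrightarrow> cinner (e i) (orthonormal_proj I e x) = cinner (e i) x"
  by (rule orthonormal_coefficient[OF _ orthonormal_proj_has_sum])

lemma is_projection_orthonormal_proj:
  assumes on: "orthonormal_family I e"
  shows "is_projection (orthonormal_proj I e)"
proof -
  let ?P = "orthonormal_proj I e"
  note hs = orthonormal_proj_has_sum[OF on]
  \<comment> \<open>\<open>?P\<close> preserves the coefficients of \<open>y\<close>, and these are
    all that \<open>cinner (?P x) y\<close> depends on. Symmetry, linearity, contractivity and
    idempotence are all derived from this identity.\<close>
  have half: "cinner (?P x) y = cinner (?P x) (?P y)" for x y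
  proof -
    have "((\<lambda>i. cinner (cinner (e i) x *\<^sub>C e i) z) has_sum cinner (?P x) z) I" for z
      by (rule has_sum_bounded_linear[OF bounded_linear_cinner_left hs])
    from this[of y] this[of "?P y"] show ?thesis
      using cinner_orthonormal_proj[OF on]
      by (simp add: cinner_scaleC_left has_sum_unique cong: has_sum_cong)
  qed
  have sym: "cinner (?P x) y = cinner x (?P y)" for x y
    by (metis half cinner_commute)
  have cs: "?P (c *\<^sub>C x) = c *\<^sub>C ?P x" for c x
    by (rule cinner_eqI) (simp add: sym cinner_scaleC_left)
  have "bounded_linear ?P"
  proof (rule bounded_linear_intro[where K = 1])
    show "?P (x + y) = ?P x + ?P y" for x y
      by (rule cinner_eqI) (simp add: sym cinner_add_left)
    show "?P (r *\<^sub>R x) = r *\<^sub>R ?P x" for r x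
      using cs[of "complex_of_real r" x] by (simp add: scaleC_of_real)
    show "norm (?P x) \<le> norm x * 1" for x
      using norm_le_if_cinner_self[of "?P x" x] half sym by simp
  qed
  then have "bounded_clinear ?P"
    using cs by (simp add: bounded_clinear_def)
  moreover have "?P (?P x) = ?P x" for x
    by (rule cinner_eqI) (metis half sym)
  ultimately show ?thesis
    using sym by (intro is_projectionI)
qed

lemma Bessel_inequality:
  assumes on: "orthonormal_family F e" and fin: "finite F"
  shows "(\<Sum>i\<in>F. (cmod (cinner (e i) x))\<^sup>2) \<le> (norm x)\<^sup>2"
proof -
  have "orthonormal_proj F e x = (\<Sum>i\<in>F. cinner (e i) x *\<^sub>C e i)"
    unfolding orthonormal_proj_def using fin by simp
  then have "(\<Sum>i\<in>F. (cmod (cinner (e i) x))\<^sup>2) = (norm (orthonormal_proj F e x))\<^sup>2"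
    using orthonormal_norm_sum[OF on fin subset_refl, of "\<lambda>i. cinner (e i) x"] by simp
  also have "\<dots> \<le> (norm x)\<^sup>2"
    by (intro power_mono is_projection_norm_le is_projection_orthonormal_proj on) simp
  finally show ?thesis .
qed

lemma orthonormal_proj_closure:
  assumes on: "orthonormal_family I e" and W: "complex_vector.subspace W" "e ` I \<subseteq> W"
  shows "orthonormal_proj I e x \<in> closure W"
proof (rule Lim_in_closed_set[OF closed_closure])
  show "(sum (\<lambda>i. cinner (e i) x *\<^sub>C e i) \<longlongrightarrow> orthonormal_proj I e x) (finite_subsets_at_top I)"
    using orthonormal_proj_has_sum[OF on] by (simp add: has_sum_def)
  show "\<forall>\<^sub>F F in finite_subsets_at_top I. (\<Sum>i\<in>F. cinner (e i) x *\<^sub>C e i) \<in> closure W"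
  proof (rule eventually_finite_subsets_at_top_weakI)
    fix F assume "finite F" "F \<subseteq> I"
    then have "(\<Sum>i\<in>F. cinner (e i) x *\<^sub>C e i) \<in> W"
      using W by (intro complex_vector.subspace_sum complex_vector.subspace_scale) auto
    then show "(\<Sum>i\<in>F. cinner (e i) x *\<^sub>C e i) \<in> closure W"
      using closure_subset by blast
  qed
qed simp

text \<open>The difference of \<open>x\<close> and its projection is orthogonal to the family, hence
  zero, so \<open>x\<close> is a limit of finite combinations.\<close>

lemma orthonormal_basisI:
  assumes on: "orthonormal_family I e" and z: "\<And>x. (\<And>i. i \<in> I \<Longrightarrow> cinner (e i) x = 0) \<Longrightarrow> x = 0"
  shows "orthonormal_basis I e"
proof -
  have "x \<in> closure (cspan (e ` I))" for x
  proof -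
    have "x - orthonormal_proj I e x = 0"
      by (rule z) (simp add: cinner_diff_right cinner_orthonormal_proj[OF on])
    moreover have "orthonormal_proj I e x \<in> closure (cspan (e ` I))"
      by (intro orthonormal_proj_closure on complex_vector.subspace_span complex_vector.span_superset)
    ultimately show ?thesis
      by simp
  qed
  then show ?thesis
    using on by (auto simp: orthonormal_basis_def)
qed

lemma Parseval_cinner:
  assumes "orthonormal_basis I e"
  shows "((\<lambda>i. cinner x (e i) * cinner (e i) y) has_sum cinner x y) I"
  using has_sum_bounded_linear[OF bounded_linear_cinner_right orthonormal_basis_expansion[OF assms]]
  by (simp add: cinner_scaleC_right mult.commute)

lemma cinner_sgn_self: "x \<noteq> 0 \<Longrightarrow> cinner (sgn x) (sgn x) = 1" for x :: "'a::chilbert_space"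
  by (simp add: cinner_self norm_sgn)

lemma subspace_sgn: "complex_vector.subspace W \<Longrightarrow> x \<in> W \<Longrightarrow> sgn x \<in> W" for W :: "'a::chilbert_space set"
  using complex_vector.subspace_scale[of W x "complex_of_real (inverse (norm x))"]
  by (simp only: sgn_div_norm scaleC_of_real)

lemma cinner_sgn_zero: "cinner e x = 0 \<Longrightarrow> cinner e (sgn x) = 0" for x :: "'a::chilbert_space"
  by (simp add: sgn_div_norm cinner_scaleR_right)

lemma orthonormal_insert:
  assumes "orthonormal_family E (\<lambda>x. x)" "cinner u u = 1" "\<And>e. e \<in> E \<Longrightarrow> cinner e u = 0"
  shows "orthonormal_family (insert u E) (\<lambda>x. x)" "u \<notin> E"
proof -
  have "cinner u e = 0" if "e \<in> E" for e
    using assms(3)[OF that] cinner_commute[of u e] by simp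
  then show "orthonormal_family (insert u E) (\<lambda>x. x)"
    using assms unfolding orthonormal_family_def by fastforce
  show "u \<notin> E"
    using assms(2,3) by force
qed

text \<open>Zorn's lemma: a unit vector of \<open>S\<close> orthogonal to a maximal \<open>E\<close>
  could be adjoined to it. \<open>S\<close> is an arbitrary set because it is applied not only to
  closed subspaces but also to the set of joint eigenvectors, which need not be a subspace.\<close>

lemma maximal_orthonormal_subset:
  fixes S :: "'a::chilbert_space set"
  obtains E where "E \<subseteq> S" "orthonormal_family E (\<lambda>x. x)"
    "\<And>u. u \<in> S \<Longrightarrow> cinner u u = 1 \<Longrightarrow> \<exists>e\<in>E. cinner e u \<noteq> 0"
proof -
  let ?A = "{E. E \<subseteq> S \<and> orthonormal_family E (\<lambda>x. x)}"
  have "\<Union>C \<in> ?A" if C: "subset.chain ?A C" for C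
  proof -
    have "cinner x y = (if x = y then 1 else 0)" if xy: "x \<in> \<Union>C" "y \<in> \<Union>C" for x y
    proof -
      obtain Z where "Z \<in> C" "x \<in> Z" "y \<in> Z"
        using C xy unfolding subset_chain_def by blast
      moreover have "orthonormal_family Z (\<lambda>x. x)"
        using C \<open>Z \<in> C\<close> unfolding subset_chain_def by blast
      ultimately show ?thesis
        unfolding orthonormal_family_def by blast
    qed
    moreover have "\<Union>C \<subseteq> S"
      using C unfolding subset_chain_def by blast
    ultimately show ?thesis
      unfolding orthonormal_family_def by blast
  qed
  from subset_Zorn'[of ?A, OF this]
  obtain E where E: "E \<in> ?A" and m: "\<forall>X\<in>?A. E \<subseteq> X \<longrightarrow> X = E"
    by (rule bexE)
  have max: "X = E" if "X \<in> ?A" "E \<subseteq> X" for X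
    using bspec[OF m that(1)] that(2) by (rule mp)
  have "\<exists>e\<in>E. cinner e u \<noteq> 0" if "u \<in> S" "cinner u u = 1" for u
    using orthonormal_insert[of E u] max[of "insert u E"] E that by blast
  then show ?thesis
    using E that by blast
qed

text \<open>Project onto the closed span of a maximal orthonormal subset of \<open>W\<close>. If
  some vector of \<open>W\<close> were not fixed, its normalised remainder would be a unit vector of
  \<open>W\<close> orthogonal to that subset.\<close>

lemma closed_subspace_projection:
  fixes W :: "'a::chilbert_space set"
  assumes W: "complex_vector.subspace W" "closed W"
  obtains P where "is_projection P" "range P = W"
proof -
  obtain E where E: "E \<subseteq> W" "orthonormal_family E (\<lambda>x. x)"
    and max: "\<And>u. u \<in> W \<Longrightarrow> cinner u u = 1 \<Longrightarrow> \<exists>e\<in>E. cinner e u \<noteq> 0"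
    using maximal_orthonormal_subset[of W] by blast
  let ?P = "orthonormal_proj E (\<lambda>x. x)"
  have in_W: "?P x \<in> W" for x
    using orthonormal_proj_closure[OF E(2) W(1)] E(1) W(2) by (simp add: image_subset_iff subset_iff)
  have "?P x = x" if "x \<in> W" for x
  proof (rule ccontr)
    assume "?P x \<noteq> x"
    then have "cinner (sgn (x - ?P x)) (sgn (x - ?P x)) = 1"
      by (intro cinner_sgn_self) auto
    moreover have "sgn (x - ?P x) \<in> W"
      using W in_W that by (intro subspace_sgn complex_vector.subspace_diff)
    ultimately show False
      using max cinner_sgn_zero[of _ "x - ?P x"] cinner_orthonormal_proj[OF E(2)]
      by (metis cinner_diff_right right_minus_eq)
  qed
  then have "range ?P = W"
    using in_W by (auto intro: range_eqI[OF sym])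
  then show ?thesis
    using that is_projection_orthonormal_proj[OF E(2)] by blast
qed

section \<open>Self-adjoint Hilbert--Schmidt operators have eigenvectors\<close>

lemma hs_eqI: "(\<And>x. hs_op S x = hs_op T x) \<Longrightarrow> S = T"
  by (simp add: hs_op_inject[symmetric] fun_eq_iff)

lemma hs_cinner_has_sum: "((\<lambda>b. cinner (hs_op S b) (hs_op T b)) has_sum cinner S T) some_basis"
  unfolding cinner_hs_def hs_cinner_def by (intro has_sum_infsum hs_cinner_summable)

lemma cinner_left_mult:
  assumes "bounded_clinear x"
  shows "cinner (left_mult x S) T = cinner S (left_mult (cadjoint x) T)"
  unfolding cinner_hs_def hs_cinner_def
  by (simp add: hs_op_left_mult bounded_clinear_cadjoint assms cinner_cadjoint_right)

lemma norm_left_mult_le: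
  assumes x: "bounded_clinear x" and "\<And>y. norm (x y) \<le> norm y"
  shows "norm (left_mult x S) \<le> norm S"
proof -
  have "(norm (left_mult x S))\<^sup>2 \<le> (norm S)\<^sup>2"
    unfolding norm_hs_sq using assms(2)
    by (intro infsum_mono hs_summable) (simp add: hs_op_left_mult[OF x] power_mono)
  then show ?thesis
    by simp
qed

lemma bounded_linear_hs_op_apply: "bounded_linear (\<lambda>T. hs_op T x)"
proof (rule bounded_linear_intro[where K = "norm x"])
  show "norm (hs_op T x) \<le> norm T * norm x" for T
    by (rule norm_hs_op_le)
qed (simp_all add: plus_hs.rep_eq scaleR_hs.rep_eq)

lemma norm_diff_sq_cinner:
  "(norm (x - y))\<^sup>2 = (norm x)\<^sup>2 + (norm y)\<^sup>2 - 2 * Re (cinner x y)" for x :: "'a::chilbert_space"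
  by (simp add: Re_cinner power2_norm_eq_inner inner_diff_left inner_diff_right inner_commute)

text \<open>The even powers of a self-adjoint contraction \<open>t\<close> converge to the projection onto the kernel of
  \<open>t\<^sup>2 - 1\<close>: the inner product of \<open>t\<^sup>m\<close> and \<open>t\<^sup>n\<close> depends on \<open>m + n\<close> only, so the norms of the powers
  control all the distances.\<close>

lemma hs_contraction_eigenvector:
  fixes T :: "'a::chilbert_space hs"
  defines "t \<equiv> hs_op T"
  assumes sym: "\<And>x y. cinner (t x) y = cinner x (t y)"
    and contr: "\<And>x. norm (t x) \<le> norm x"
    and top: "\<And>d. d > 0 \<Longrightarrow> \<exists>x. norm x = 1 \<and> norm (t x) > 1 - d"
  obtains y where "y \<noteq> 0" "t (t y) = y"
proof -
  have t: "bounded_clinear t"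
    unfolding t_def by (rule hs_bounded_clinear)
  interpret t: bounded_linear t
    using t by (rule bounded_clinear_linear)
  have adj: "cadjoint t = t"
    by (rule cadjoint_eqI) (rule sym)
  \<comment> \<open>\<open>Y 0\<close> is \<open>T\<close>, so \<open>Y k\<close> represents the
    power \<open>k + 1\<close> of \<open>t\<close>. Starting from \<open>T\<close> keeps the
    sequence in the Hilbert-Schmidt space.\<close>
  define Y where "Y k = (left_mult t ^^ k) T" for k
  have Y_Suc: "Y (Suc k) = left_mult t (Y k)" for k
    by (simp add: Y_def)
  have op_Suc: "hs_op (Y (Suc k)) x = t (hs_op (Y k) x)" for k x
    by (simp add: Y_Suc hs_op_left_mult[OF t])
  have shift: "cinner (Y (Suc k)) (Y l) = cinner (Y k) (Y (Suc l))" for k l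
    using cinner_left_mult[OF t, of "Y k" "Y l"] by (simp add: Y_Suc adj)
  have inn: "cinner (Y k) (Y l) = cinner (Y 0) (Y (k + l))" for k l
    by (induction k arbitrary: l) (simp_all add: shift)
  have "decseq (\<lambda>k. (norm (Y k))\<^sup>2)"
    unfolding decseq_Suc_iff Y_Suc by (intro allI power_mono norm_left_mult_le t contr) simp
  then have "convergent (\<lambda>k. (norm (Y k))\<^sup>2)"
    using decseq_convergent[of "\<lambda>k. (norm (Y k))\<^sup>2" 0] by (auto simp: convergent_def)
  then have bC: "Cauchy (\<lambda>k. (norm (Y k))\<^sup>2)"
    by (rule convergent_Cauchy)
  \<comment> \<open>\<open>X n\<close> represents the power \<open>2 * n + 1\<close>, so passing to
    the next term multiplies by \<open>t \<circ> t\<close>. Even indices turn the inner product of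
    \<open>X m\<close> and \<open>X n\<close> into the squared norm of
    \<open>Y (m + n)\<close>.\<close>
  define X where "X n = Y (2 * n)" for n
  have dX: "(norm (X m - X n))\<^sup>2 = (norm (Y (2 * m)))\<^sup>2 + (norm (Y (2 * n)))\<^sup>2 - 2 * (norm (Y (m + n)))\<^sup>2" for m n
  proof -
    have "cinner (X m) (X n) = cinner (Y (m + n)) (Y (m + n))"
      unfolding X_def inn[of "2 * m"] inn[of "m + n"] by (rule arg_cong[where f = "\<lambda>k. cinner (Y 0) (Y k)"]) simp
    then have "Re (cinner (X m) (X n)) = (norm (Y (m + n)))\<^sup>2"
      by (simp add: cinner_self del: of_real_power)
    then show ?thesis
      unfolding norm_diff_sq_cinner by (simp add: X_def)
  qed
  have "Cauchy X"
  proof (rule CauchyI)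
    fix d :: real assume "d > 0"
    then have "d\<^sup>2 / 2 > 0"
      by simp
    from CauchyD[OF bC this] obtain N where
      N: "\<And>k l. k \<ge> N \<Longrightarrow> l \<ge> N \<Longrightarrow> \<bar>(norm (Y k))\<^sup>2 - (norm (Y l))\<^sup>2\<bar> < d\<^sup>2 / 2"
      by auto
    have "norm (X m - X n) < d" if "m \<ge> N" "n \<ge> N" for m n
    proof -
      have "\<bar>(norm (Y (2 * m)))\<^sup>2 - (norm (Y (m + n)))\<^sup>2\<bar> < d\<^sup>2 / 2"
           "\<bar>(norm (Y (2 * n)))\<^sup>2 - (norm (Y (m + n)))\<^sup>2\<bar> < d\<^sup>2 / 2"
        using that by (intro N; simp)+
      then have "(norm (X m - X n))\<^sup>2 < d\<^sup>2"
        unfolding dX by linarith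
      then show ?thesis
        using \<open>d > 0\<close> by (simp add: power2_less_imp_less)
    qed
    then show "\<exists>M. \<forall>m\<ge>M. \<forall>n\<ge>M. norm (X m - X n) < d"
      by blast
  qed
  then obtain Q where Q: "X \<longlonglongrightarrow> Q"
    using Cauchy_convergent by (auto simp: convergent_def)
  have fix_Q: "t (t (hs_op Q x)) = hs_op Q x" for x
  proof -
    have lim: "(\<lambda>n. hs_op (X n) x) \<longlonglongrightarrow> hs_op Q x"
      by (rule bounded_linear.tendsto[OF bounded_linear_hs_op_apply Q])
    then have "(\<lambda>n. t (t (hs_op (X n) x))) \<longlonglongrightarrow> t (t (hs_op Q x))"
      by (intro t.tendsto)
    moreover have "t (t (hs_op (X n) x)) = hs_op (X (Suc n)) x" for n
      by (simp add: X_def op_Suc)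
    ultimately show ?thesis
      using LIMSEQ_unique LIMSEQ_Suc[OF lim] by simp
  qed
  \<comment> \<open>If the limit were zero, some \<open>X n\<close> would have norm below 1/4. A
    unit vector \<open>v\<close> that almost attains the norm of \<open>t\<close> is moved by
    \<open>t \<circ> t\<close> by at most \<open>h\<close>, so \<open>X n\<close> applied to
    \<open>v\<close> differs from \<open>t v\<close> by at most \<open>real n * h\<close>. The
    choice of \<open>h\<close> makes this at most 1/4, although \<open>t v\<close> has norm above
    3/4.\<close>
  have "Q \<noteq> 0"
  proof
    assume "Q = 0"
    then obtain n where n: "norm (X n) < 1 / 4"
      using LIMSEQ_D[OF Q, of "1 / 4"] by auto
    define h where "h = 1 / (4 * (real n + 1))"
    have h: "h > 0" "real n * h \<le> 1 / 4" "h \<le> 1 / 4"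
      by (auto simp: h_def field_simps)
    obtain v where v: "norm v = 1" "norm (t v) > 1 - h\<^sup>2 / 2"
      using top[of "h\<^sup>2 / 2"] h(1) by auto
    have h2: "h\<^sup>2 \<le> 1 / 4"
      using h mult_mono[of h 1 h "1/4"] by (simp add: power2_eq_square)
    have "(norm (v - t (t v)))\<^sup>2 = 1 + (norm (t (t v)))\<^sup>2 - 2 * (norm (t v))\<^sup>2"
      using v(1) by (simp add: norm_diff_sq_cinner sym[symmetric] cinner_self del: of_real_power)
    also have "\<dots> \<le> 1 - (norm (t v))\<^sup>2"
      using power_mono[OF contr[of "t v"], of 2] by simp
    also have "\<dots> \<le> h\<^sup>2"
    proof -
      have "(1 - h\<^sup>2 / 2)\<^sup>2 \<le> (norm (t v))\<^sup>2"
        using v(2) h2 by (intro power_mono) auto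
      moreover have "(1 - h\<^sup>2 / 2)\<^sup>2 \<ge> 1 - h\<^sup>2"
        by (simp add: power2_diff)
      ultimately show ?thesis
        by linarith
    qed
    finally have step: "norm (v - t (t v)) \<le> h"
      by (rule power2_le_imp_le) (use h(1) in simp)
    have "norm (t v - hs_op (X k) v) \<le> real k * h" for k
    proof (induction k)
      case (Suc k)
      have "t v - hs_op (X (Suc k)) v = t (v - t (t v)) + t (t (t v - hs_op (X k) v))"
        by (simp add: X_def op_Suc t.diff)
      also have "norm \<dots> \<le> norm (v - t (t v)) + norm (t v - hs_op (X k) v)"
        by (intro norm_triangle_le add_mono contr order_trans[OF contr contr])
      finally show ?case
        using step Suc by (simp add: algebra_simps)
    qed (simp add: X_def Y_def t_def)
    then have "norm (t v - hs_op (X n) v) \<le> 1 / 4"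
      using h(2) order_trans by blast
    moreover have "norm (hs_op (X n) v) < 1 / 4"
      using norm_hs_op_le[of "X n" v] v(1) n by simp
    moreover have "norm (t v) > 3 / 4"
      using v(2) h2 by linarith
    moreover have "norm (t v) \<le> norm (t v - hs_op (X n) v) + norm (hs_op (X n) v)"
      by (metis diff_add_cancel norm_triangle_ineq)
    ultimately show False
      by linarith
  qed
  then obtain x where "hs_op Q x \<noteq> 0"
    using hs_eqI[of Q 0] by (auto simp: zero_hs.rep_eq)
  then show ?thesis
    using that fix_Q by blast
qed

text \<open>Division by the operator norm \<open>s\<close> reduces to the preceding contraction
  lemma, so \<open>A\<close> applied twice multiplies some nonzero \<open>y\<close> by the square of
  \<open>s\<close>. Then either \<open>A y + s *\<^sub>R y\<close> is zero and \<open>y\<close> has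
  eigenvalue \<open>- s\<close>, or that sum is an eigenvector for \<open>s\<close>.\<close>

lemma hs_symmetric_eigenvector:
  fixes A :: "'a::chilbert_space \<Rightarrow> 'a"
  assumes A: "hilbert_schmidt A" and sym: "\<And>x y. cinner (A x) y = cinner x (A y)"
    and nz: "A z \<noteq> 0"
  obtains c y where "c \<noteq> 0" "y \<noteq> 0" "A y = c *\<^sub>C y"
proof -
  have lin: "bounded_linear A"
    using A by (simp add: hilbert_schmidt_iff bounded_clinear_def)
  interpret A: bounded_linear A by (rule lin)
  define s where "s = onorm A"
  have s: "s > 0"
    using nz onorm_pos_lt[OF lin] by (auto simp: s_def)
  define T where "T = Abs_hs (\<lambda>x. inverse s *\<^sub>R A x)"
  have T: "hs_op T = (\<lambda>x. inverse s *\<^sub>R A x)"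
    unfolding T_def using hilbert_schmidt_scaleR[OF A] by (simp add: Abs_hs_inverse)
  obtain y where y: "y \<noteq> 0" "hs_op T (hs_op T y) = y"
  proof (rule hs_contraction_eigenvector[of T])
    show "cinner (hs_op T x) y = cinner x (hs_op T y)" for x y
      by (simp add: T cinner_scaleR_left cinner_scaleR_right sym)
    show "norm (hs_op T x) \<le> norm x" for x
      using onorm[OF lin, of x] s by (simp add: T s_def[symmetric] field_simps)
    show "\<exists>x. norm x = 1 \<and> norm (hs_op T x) > 1 - d" if "d > 0" for d
    proof (rule ccontr)
      assume no: "\<not> ?thesis"
      \<comment> \<open>The cut-off at 0 keeps this a legitimate bound for the operator norm when
        \<open>d > 1\<close>.\<close>
      define d' where "d' = max 0 (1 - d)"
      have "norm (A x) \<le> (d' * s) * norm x" for x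
      proof (cases "x = 0")
        case False
        then have "norm (hs_op T (sgn x)) \<le> 1 - d"
          using no by (auto simp: norm_sgn not_less)
        then have "norm (A x) \<le> (1 - d) * s * norm x"
          using False s by (simp add: T sgn_div_norm A.scaleR field_simps)
        also have "\<dots> \<le> d' * s * norm x"
          using s by (intro mult_right_mono) (auto simp: d'_def)
        finally show ?thesis .
      qed (simp add: A.zero)
      then have "s \<le> d' * s"
        unfolding s_def[symmetric] using s onorm_bound[of "d' * s" A] by (simp add: s_def d'_def)
      then show False
        using s that by (simp add: d'_def split: if_splits)
    qed
  qed
  then have "inverse s *\<^sub>R inverse s *\<^sub>R A (A y) = y"
    by (simp add: T A.scaleR)
  then have "s *\<^sub>R s *\<^sub>R inverse s *\<^sub>R inverse s *\<^sub>R A (A y) = s *\<^sub>R s *\<^sub>R y"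
    by simp
  moreover have "s * (s * (inverse s * inverse s)) = 1"
    using s by (simp add: field_simps)
  ultimately have AA: "A (A y) = s *\<^sub>R s *\<^sub>R y"
    by simp
  show ?thesis
  proof (cases "A y + s *\<^sub>R y = 0")
    case True
    then have "A y = complex_of_real (- s) *\<^sub>C y"
      by (simp add: scaleC_of_real eq_neg_iff_add_eq_0)
    then show ?thesis
      using that[of "complex_of_real (- s)" y] y s by simp
  next
    case False
    have "A (A y + s *\<^sub>R y) = complex_of_real s *\<^sub>C (A y + s *\<^sub>R y)"
      by (simp add: scaleC_of_real A.add A.scaleR AA scaleR_add_right)
    then show ?thesis
      using that[of "complex_of_real s" "A y + s *\<^sub>R y"] False s by simp
  qed
qed

text \<open>Compressing by the projection onto \<open>W\<close> reduces to the previous lemma.\<close>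

lemma hs_symmetric_eigenvector_in:
  fixes A :: "'a::chilbert_space \<Rightarrow> 'a"
  assumes A: "hilbert_schmidt A" and sym: "\<And>x y. cinner (A x) y = cinner x (A y)"
    and W: "complex_vector.subspace W" "closed W" and inv: "\<And>x. x \<in> W \<Longrightarrow> A x \<in> W"
    and z: "z \<in> W" "A z \<noteq> 0"
  obtains c y where "c \<noteq> 0" "y \<noteq> 0" "y \<in> W" "A y = c *\<^sub>C y"
proof -
  obtain P where P: "is_projection P" and PW: "range P = W"
    using closed_subspace_projection[OF W] by blast
  have Pfix: "P x = x" if "x \<in> W" for x
    using that PW is_projection_range_iff[OF P] by blast
  have PW': "P x \<in> W" for x
    using PW by blast
  \<comment> \<open>An invariant subspace of a self-adjoint operator reduces it. The commutation
    makes \<open>P \<circ> A\<close> self-adjoint.\<close>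
  have comm: "P (A x) = A (P x)" for x
  proof (rule cinner_eqI)
    fix w
    have "cinner (P (A x)) w = cinner x (P (A (P w)))"
      by (simp add: is_projection_symmetric[OF P] sym Pfix[OF inv[OF PW']])
    also have "\<dots> = cinner (P (A (P x))) w"
      by (simp add: is_projection_symmetric[OF P] sym)
    finally show "cinner (P (A x)) w = cinner (A (P x)) w"
      by (simp add: Pfix[OF inv[OF PW']])
  qed
  have "hilbert_schmidt (P \<circ> A)"
    by (rule hilbert_schmidt_left_mult[OF is_projection_bounded[OF P] A])
  moreover have "cinner ((P \<circ> A) x) y = cinner x ((P \<circ> A) y)" for x y
    by (simp add: is_projection_symmetric[OF P] sym comm)
  moreover have "(P \<circ> A) z \<noteq> 0"
    using z by (simp add: Pfix inv)
  ultimately obtain c y where y: "c \<noteq> 0" "y \<noteq> 0" "(P \<circ> A) y = c *\<^sub>C y"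
    using hs_symmetric_eigenvector by metis
  \<comment> \<open>As the eigenvalue is nonzero, the eigenvector of the compression lies in the
    range of \<open>P\<close>.\<close>
  have "y = (1 / c) *\<^sub>C P (A y)"
    using y by (simp add: scaleC_scaleC)
  then have "y \<in> W"
    using complex_vector.subspace_scale[OF W(1) PW'] by metis
  then show ?thesis
    using that[of c y] y by (simp add: Pfix inv)
qed

section \<open>Joint eigenvectors\<close>

lemma
  assumes "bounded_clinear A"
  shows subspace_eigenspace: "complex_vector.subspace {y. A y = c *\<^sub>C y}"
    and closed_eigenspace: "closed {y. A y = c *\<^sub>C y}"
proof -
  interpret bounded_linear A
    using assms by (rule bounded_clinear_linear)
  show "complex_vector.subspace {y. A y = c *\<^sub>C y}"
    by (auto simp: complex_vector.subspace_def zero add scaleC_add_right bounded_clinear_scaleC[OF assms]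
        scaleC_scaleC mult.commute)
  show "closed {y. A y = c *\<^sub>C y}"
    by (intro closed_Collect_eq continuous_on continuous_on_id
        bounded_linear.continuous_on[OF bounded_linear_scaleC_right])
qed

text \<open>An eigenspace of \<open>A\<close> with nonzero eigenvalue, cut down to \<open>W\<close>,
  is invariant under \<open>B\<close>. There \<open>B\<close> either has an eigenvector or vanishes,
  and in the latter case every vector has eigenvalue 0.\<close>

lemma hs_commuting_symmetric_eigenvector_in:
  fixes A B :: "'a::chilbert_space \<Rightarrow> 'a"
  assumes A: "hilbert_schmidt A" "\<And>x y. cinner (A x) y = cinner x (A y)"
    and B: "hilbert_schmidt B" "\<And>x y. cinner (B x) y = cinner x (B y)"
    and AB: "\<And>x. A (B x) = B (A x)"
    and W: "complex_vector.subspace W" "closed W"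
    and inv: "\<And>x. x \<in> W \<Longrightarrow> A x \<in> W" "\<And>x. x \<in> W \<Longrightarrow> B x \<in> W"
    and z: "z \<in> W" "A z \<noteq> 0"
  obtains a b y where "y \<noteq> 0" "y \<in> W" "A y \<noteq> 0" "A y = a *\<^sub>C y" "B y = b *\<^sub>C y"
proof -
  have lin: "bounded_clinear A" "bounded_clinear B"
    using A B by (auto simp: hilbert_schmidt_iff)
  obtain a y where y: "a \<noteq> 0" "y \<noteq> 0" "y \<in> W" "A y = a *\<^sub>C y"
    using hs_symmetric_eigenvector_in[OF A W inv(1) z] by metis
  define V where "V = W \<inter> {y. A y = a *\<^sub>C y}"
  have V: "complex_vector.subspace V" "closed V"
    unfolding V_def using W lin
    by (auto intro!: complex_vector.subspace_inter subspace_eigenspace closed_eigenspace closed_Int)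
  have BV: "B x \<in> V" if "x \<in> V" for x
    using that inv by (auto simp: V_def AB bounded_clinear_scaleC[OF lin(2)])
  have nz: "A x \<noteq> 0" if "x \<in> V" "x \<noteq> 0" for x
    using that y(1) by (simp add: V_def)
  show ?thesis
  proof (cases "\<exists>x\<in>V. B x \<noteq> 0")
    case True
    then obtain b x where "x \<noteq> 0" "x \<in> V" "B x = b *\<^sub>C x"
      using hs_symmetric_eigenvector_in[OF B V BV] by metis
    then show ?thesis
      using that[of x a b] nz by (auto simp: V_def)
  next
    case False
    then have "B y = 0 *\<^sub>C y"
      using y by (auto simp: V_def)
    then show ?thesis
      using that[of y a 0] y nz[of y] by (auto simp: V_def)
  qed
qed

text \<open>By normality \<open>R\<close> and its adjoint give \<open>x\<close> images of equal
  norm, so the squared norm of the difference of the two sides expands to zero.\<close>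

lemma normal_eigenvector_cadjoint:
  assumes R: "bounded_clinear R" and normal: "\<And>x. R (cadjoint R x) = cadjoint R (R x)"
    and x: "R x = c *\<^sub>C x"
  shows "cadjoint R x = cnj c *\<^sub>C x"
proof -
  let ?y = "cadjoint R x"
  have yy: "cinner ?y ?y = cnj c * c * cinner x x"
    by (simp add: cinner_cadjoint[OF R] normal cinner_cadjoint_right[OF R] x
        cinner_scaleC_left cinner_scaleC_right)
  have yx: "cinner ?y x = c * cinner x x"
    by (simp add: cinner_cadjoint[OF R] x cinner_scaleC_right)
  have xy: "cinner x ?y = cnj c * cinner x x"
    by (simp add: cinner_cadjoint_right[OF R] x cinner_scaleC_left)
  have "cinner (?y - cnj c *\<^sub>C x) (?y - cnj c *\<^sub>C x) = 0"
    by (simp add: cinner_diff_left cinner_diff_right cinner_scaleC_left cinner_scaleC_right yy yx xy)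
  then show ?thesis
    by (simp add: cinner_self)
qed

text \<open>The real and imaginary parts of a normal operator are commuting self-adjoint operators,
  and a joint eigenvector of both is an eigenvector of \<open>R\<close>.\<close>

lemma hs_normal_eigenvector_in:
  fixes R :: "'a::chilbert_space \<Rightarrow> 'a"
  assumes R: "hilbert_schmidt R" and normal: "\<And>x. R (cadjoint R x) = cadjoint R (R x)"
    and W: "complex_vector.subspace W" "closed W"
    and inv: "\<And>x. x \<in> W \<Longrightarrow> R x \<in> W" "\<And>x. x \<in> W \<Longrightarrow> cadjoint R x \<in> W"
    and w: "w \<in> W" "R w \<noteq> 0"
  obtains c y where "c \<noteq> 0" "y \<noteq> 0" "y \<in> W" "R y = c *\<^sub>C y"
proof -
  have lin: "bounded_clinear R" "bounded_clinear (cadjoint R)"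
    using R by (auto simp: hilbert_schmidt_iff bounded_clinear_cadjoint)
  interpret R: bounded_linear R
    using lin by (intro bounded_clinear_linear)
  interpret S: bounded_linear "cadjoint R"
    using lin by (intro bounded_clinear_linear)
  note Rc = bounded_clinear_scaleC[OF lin(1)] and Sc = bounded_clinear_scaleC[OF lin(2)]
  have hS: "hilbert_schmidt (cadjoint R)"
    using R by (rule hilbert_schmidt_cadjoint)
  \<comment> \<open>\<open>A\<close> is twice the real part of \<open>R\<close>, and
    \<open>B\<close> is minus twice its imaginary part.\<close>
  define A where "A x = R x + cadjoint R x" for x
  define B where "B x = \<i> *\<^sub>C (R x + (- 1) *\<^sub>C cadjoint R x)" for x
  have hA: "hilbert_schmidt A" and hB: "hilbert_schmidt B"
    unfolding A_def B_def by (intro hilbert_schmidt_add hilbert_schmidt_scaleC R hS)+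
  have sA: "cinner (A x) y = cinner x (A y)" for x y
    by (simp add: A_def cinner_add_left cinner_add_right cinner_cadjoint[OF lin(1)]
        cinner_cadjoint_right[OF lin(1)])
  have sB: "cinner (B x) y = cinner x (B y)" for x y
    unfolding B_def cinner_scaleC_left cinner_scaleC_right cinner_add_left cinner_add_right
      cinner_cadjoint[OF lin(1)] cinner_cadjoint_right[OF lin(1)]
    by (simp add: algebra_simps)
  have AB: "A (B x) = B (A x)" for x
    by (simp add: A_def B_def R.add S.add R.diff S.diff Rc Sc normal scaleC_add_right scaleC_scaleC algebra_simps)
  have iA: "A x \<in> W" and iB: "B x \<in> W" if "x \<in> W" for x
    unfolding A_def B_def using that inv
    by (intro complex_vector.subspace_add complex_vector.subspace_scale W; simp)+
  have AB_R: "R x = (1/2) *\<^sub>C (A x + (- \<i>) *\<^sub>C B x)" for x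
    by (simp add: A_def B_def scaleC_scaleC scaleC_add_right flip: scaleC_add_left)
  have fin: thesis if y: "y \<noteq> 0" "y \<in> W" "A y = a *\<^sub>C y" "B y = b *\<^sub>C y" "A y \<noteq> 0 \<or> B y \<noteq> 0" for y a b
  proof -
    have Ry: "R y = ((1/2) * (a - \<i> * b)) *\<^sub>C y"
      by (simp only: AB_R y(3,4) scaleC_scaleC flip: scaleC_add_left) (simp add: algebra_simps)
    \<comment> \<open>If the eigenvalue were 0, the adjoint would annihilate \<open>y\<close> as
      well, and with it \<open>A\<close> and \<open>B\<close>.\<close>
    moreover have "(1/2) * (a - \<i> * b) \<noteq> 0"
    proof
      assume "(1/2) * (a - \<i> * b) = 0"
      then have "R y = 0 *\<^sub>C y"
        using Ry by simp
      then have "R y = 0" "cadjoint R y = 0"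
        using normal_eigenvector_cadjoint[OF lin(1) normal, of y 0] by auto
      then show False
        using y(5) by (simp add: A_def B_def)
    qed
    ultimately show thesis
      using \<open>y \<noteq> 0\<close> \<open>y \<in> W\<close> by (intro \<open>\<And>y c. c \<noteq> 0 \<Longrightarrow> y \<noteq> 0 \<Longrightarrow> y \<in> W \<Longrightarrow> R y = c *\<^sub>C y \<Longrightarrow> thesis\<close>)
  qed
  have "A w \<noteq> 0 \<or> B w \<noteq> 0"
    using AB_R[of w] w(2) by auto
  then show thesis
  proof
    assume "A w \<noteq> 0"
    from hs_commuting_symmetric_eigenvector_in[OF hA sA hB sB AB W iA iB w(1) this] fin
    show thesis by metis
  next
    assume "B w \<noteq> 0"
    from hs_commuting_symmetric_eigenvector_in[OF hB sB hA sA AB[symmetric] W iB iA w(1) this] fin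
    show thesis by metis
  qed
qed

text \<open>Each unit eigenvector contributes the squared modulus of \<open>c\<close> to the squared
  Hilbert-Schmidt norm. Bounding finite orthonormal sets expresses that the eigenspace is
  finite-dimensional.\<close>

lemma hs_eigenspace_card_bound:
  fixes R :: "'a::chilbert_space \<Rightarrow> 'a"
  assumes R: "hilbert_schmidt R" and c: "c \<noteq> 0"
  shows "\<exists>n. \<forall>F. finite F \<and> orthonormal_family F (\<lambda>x. x) \<and>
    (\<forall>y\<in>F. R y = c *\<^sub>C y) \<longrightarrow> card F \<le> n"
proof -
  have lin: "bounded_clinear R"
    using R by (auto simp: hilbert_schmidt_iff)
  define K where "K = (\<Sum>\<^sub>\<infinity>b\<in>some_basis. (norm (cadjoint R b))\<^sup>2)"
  have K: "((\<lambda>b. (norm (cadjoint R b))\<^sup>2) has_sum K) some_basis"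
    unfolding K_def using hilbert_schmidt_cadjoint[OF R]
    by (intro has_sum_infsum) (simp add: hilbert_schmidt_iff)
  obtain n where n: "K / (cmod c)\<^sup>2 \<le> real n"
    using real_arch_simple by blast
  have "card F \<le> n" if F: "finite F" "orthonormal_family F (\<lambda>x. x)" "\<And>y. y \<in> F \<Longrightarrow> R y = c *\<^sub>C y" for F
  proof -
    have "((\<lambda>b. \<Sum>f\<in>F. (cmod (cinner b (R f)))\<^sup>2) has_sum (\<Sum>f\<in>F. (norm (R f))\<^sup>2)) some_basis"
      using F(1) by (induction F rule: finite_induct)
        (simp_all add: has_sum_add Parseval[OF orthonormal_some_basis])
    moreover have "(\<Sum>f\<in>F. (cmod (cinner b (R f)))\<^sup>2) \<le> (norm (cadjoint R b))\<^sup>2" for b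
      using Bessel_inequality[OF F(2,1), of "cadjoint R b"]
      by (simp add: cinner_cadjoint_right[OF lin] cmod_cinner_commute)
    ultimately have "(\<Sum>f\<in>F. (norm (R f))\<^sup>2) \<le> K"
      by (rule has_sum_mono[OF _ K])
    moreover have "norm f = 1" if "f \<in> F" for f
    proof -
      have "cinner f f = 1"
        using F(2) that by (simp add: orthonormal_family_def)
      then show ?thesis
        by (metis cinner_self of_real_eq_1_iff norm_ge_zero power2_eq_1_iff one_neq_neg_one
            neg_0_le_iff_le not_one_le_zero)
    qed
    ultimately have "real (card F) * (cmod c)\<^sup>2 \<le> K"
      using F(3) by (simp add: norm_scaleC)
    then have "real (card F) \<le> K / (cmod c)\<^sup>2"
      using c by (simp add: field_simps)
    then show ?thesis
      using n by linarith
  qed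
  then show ?thesis
    by blast
qed

text \<open>Each eigenspace of a member of \<open>\<K>\<close> is invariant under all the members and their adjoints. An
  invariant subspace whose finite orthonormal subsets have the least possible bound on their
  cardinality therefore consists of joint eigenvectors.\<close>

lemma hs_joint_eigenvector_in:
  fixes \<K> :: "('a::chilbert_space \<Rightarrow> 'a) set"
  assumes hs: "\<And>R. R \<in> \<K> \<Longrightarrow> hilbert_schmidt R"
    and comm: "\<And>R S x. R \<in> \<K> \<Longrightarrow> S \<in> \<K> \<Longrightarrow> R (cadjoint S x) = cadjoint S (R x)"
    and W: "complex_vector.subspace W" "closed W"
    and inv: "\<And>R x. R \<in> \<K> \<Longrightarrow> x \<in> W \<Longrightarrow> R x \<in> W" "\<And>R x. R \<in> \<K> \<Longrightarrow> x \<in> W \<Longrightarrow> cadjoint R x \<in> W"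
    and w: "w \<in> W" "w \<noteq> 0"
  shows "\<exists>y\<in>W. y \<noteq> 0 \<and> (\<forall>R\<in>\<K>. \<exists>c. R y = c *\<^sub>C y)"
proof (cases "\<exists>R\<in>\<K>. \<exists>x\<in>W. R x \<noteq> 0")
  case False
  then have "R w = 0 *\<^sub>C w" if "R \<in> \<K>" for R
    using w that by auto
  then show ?thesis
    using w by blast
next
  case True
  have lin: "bounded_clinear R" if "R \<in> \<K>" for R
    using hs[OF that] by (simp add: hilbert_schmidt_iff)
  define good where "good V \<longleftrightarrow> complex_vector.subspace V \<and> closed V \<and> (\<exists>x\<in>V. x \<noteq> 0) \<and>
    V \<subseteq> W \<and> (\<forall>R\<in>\<K>. \<forall>x\<in>V. R x \<in> V \<and> cadjoint R x \<in> V)" for V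
  \<comment> \<open>This encodes that the dimension of \<open>V\<close> is at most
    \<open>n\<close>.\<close>
  define bd where "bd V n \<longleftrightarrow> (\<forall>F\<subseteq>V. finite F \<longrightarrow> orthonormal_family F (\<lambda>x. x) \<longrightarrow> card F \<le> n)"
    for V :: "'a set" and n
  have eig: "good (V \<inter> {y. R y = c *\<^sub>C y})"
    if V: "good V" and R: "R \<in> \<K>" and y: "y \<noteq> 0" "y \<in> V" "R y = c *\<^sub>C y" for V R c y
  proof -
    have "R (cadjoint S x) = c *\<^sub>C cadjoint S x" if "S \<in> \<K>" "R x = c *\<^sub>C x" for S x
      using that comm[OF R that(1)] bounded_clinear_scaleC[OF bounded_clinear_cadjoint[OF lin]] by metis
    \<comment> \<open>The hypothesis lets \<open>S\<close> commute with the adjoint of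
      \<open>R\<close>. So the step passes to the adjoint with the conjugate eigenvalue, applies
      \<open>S\<close> there, and returns by normality.\<close>
    moreover have "R (S x) = c *\<^sub>C S x" if S: "S \<in> \<K>" and x: "R x = c *\<^sub>C x" for S x
    proof -
      have "cadjoint R (S x) = S (cadjoint R x)"
        using comm[OF S R] by simp
      also have "\<dots> = cnj c *\<^sub>C S x"
        using normal_eigenvector_cadjoint[OF lin[OF R] comm[OF R R] x]
        by (simp add: bounded_clinear_scaleC[OF lin[OF S]])
      finally have "cadjoint (cadjoint R) (S x) = cnj (cnj c) *\<^sub>C S x"
        by (rule normal_eigenvector_cadjoint[rotated 2])
          (simp_all add: cadjoint_cadjoint bounded_clinear_cadjoint lin comm R)
      then show ?thesis
        by (simp add: cadjoint_cadjoint lin R)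
    qed
    ultimately show ?thesis
      using V y unfolding good_def
      by (auto intro!: complex_vector.subspace_inter subspace_eigenspace closed_eigenspace closed_Int lin[OF R])
  qed
  have "good W"
    using W inv w by (auto simp: good_def)
  \<comment> \<open>A member that does not vanish on \<open>W\<close> has a nonzero eigenvalue
    there. Its finite-dimensional eigenspace shows that some good subspace is bounded, so a least
    bound exists.\<close>
  obtain R0 x0 where R0: "R0 \<in> \<K>" and x0: "x0 \<in> W" "R0 x0 \<noteq> 0"
    using True by blast
  obtain c0 y0 where y0: "c0 \<noteq> 0" "y0 \<noteq> 0" "y0 \<in> W" "R0 y0 = c0 *\<^sub>C y0"
    using hs_normal_eigenvector_in[OF hs[OF R0] comm[OF R0 R0] W inv(1)[OF R0] inv(2)[OF R0] x0] by metis
  obtain n0 where n0: "\<forall>F. finite F \<and> orthonormal_family F (\<lambda>x. x) \<and>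
      (\<forall>y\<in>F. R0 y = c0 *\<^sub>C y) \<longrightarrow> card F \<le> n0"
    using hs_eigenspace_card_bound[OF hs[OF R0] y0(1)] by (rule exE)
  have "bd (W \<inter> {y. R0 y = c0 *\<^sub>C y}) n0"
    unfolding bd_def by (intro allI impI n0[rule_format]) auto
  then have ex: "\<exists>n V. good V \<and> bd V n"
    using eig[OF \<open>good W\<close> R0 y0(2-)] by blast
  define n where "n = (LEAST n. \<exists>V. good V \<and> bd V n)"
  obtain V where V: "good V" and n: "bd V n"
    using LeastI_ex[OF ex] unfolding n_def by blast
  have least: "n \<le> m" if "good U" "bd U m" for U m
    unfolding n_def using that by (intro Least_le) blast
  obtain y where y: "y \<in> V" "y \<noteq> 0" "y \<in> W"
    using V by (auto simp: good_def)
  have "\<exists>c. R y = c *\<^sub>C y" if R: "R \<in> \<K>" for R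
  proof -
    have VV: "complex_vector.subspace V" "closed V"
      and VR: "\<And>x. x \<in> V \<Longrightarrow> R x \<in> V" "\<And>x. x \<in> V \<Longrightarrow> cadjoint R x \<in> V"
      using V R by (auto simp: good_def)
    have "\<exists>c z. z \<noteq> 0 \<and> z \<in> V \<and> R z = c *\<^sub>C z"
    proof (cases "R y = 0")
      case True
      then show ?thesis
        using y by (intro exI[of _ 0] exI[of _ y]) simp
    next
      case False
      then show ?thesis
        using hs_normal_eigenvector_in[OF hs[OF R] comm[OF R R] VV VR y(1)] by metis
    qed
    then obtain c z where z: "z \<noteq> 0" "z \<in> V" "R z = c *\<^sub>C z"
      by blast
    define U where "U = V \<inter> {y. R y = c *\<^sub>C y}"
    have U: "good U"
      unfolding U_def by (rule eig[OF V R z])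
    have "y \<in> U"
    proof (rule ccontr)
      assume "y \<notin> U"
      \<comment> \<open>If \<open>y\<close> lies outside \<open>U\<close>, its normalised component
        orthogonal to \<open>F\<close> enlarges \<open>F\<close> within \<open>V\<close>. Hence
        \<open>U\<close> has a smaller bound than the least one.\<close>
      have card_le: "Suc (card F) \<le> n" if F: "F \<subseteq> U" "finite F" "orthonormal_family F (\<lambda>x. x)" for F
      proof -
        define u where "u = y - orthonormal_proj F (\<lambda>x. x) y"
        have "orthonormal_proj F (\<lambda>x. x) y \<in> closure U"
          using U F by (intro orthonormal_proj_closure) (auto simp: good_def)
        then have pU: "orthonormal_proj F (\<lambda>x. x) y \<in> U"
          using U by (simp add: good_def)
        then have "u \<noteq> 0"
          using \<open>y \<notin> U\<close> by (auto simp: u_def)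
        have "u \<in> V"
          unfolding u_def using pU y(1) VV(1) by (intro complex_vector.subspace_diff) (auto simp: U_def)
        have "orthonormal_family (insert (sgn u) F) (\<lambda>x. x)" "sgn u \<notin> F"
          using cinner_orthonormal_proj[OF F(3)]
          by (intro orthonormal_insert F cinner_sgn_self cinner_sgn_zero \<open>u \<noteq> 0\<close>; simp add: u_def cinner_diff_right)+
        moreover have "insert (sgn u) F \<subseteq> V"
          using F(1) subspace_sgn[OF VV(1) \<open>u \<in> V\<close>] by (auto simp: U_def)
        ultimately show ?thesis
          using n F(2) unfolding bd_def by (metis card_insert_disjoint finite_insert)
      qed
      have "bd U (n - 1)"
        unfolding bd_def
      proof (intro allI impI)
        fix F assume "F \<subseteq> U" "finite F" "orthonormal_family F (\<lambda>x. x)"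
        from card_le[OF this] show "card F \<le> n - 1"
          by simp
      qed
      \<comment> \<open>The empty family gives this; it ensures that the natural number
        \<open>n - 1\<close> is really below \<open>n\<close>.\<close>
      moreover have "n \<ge> 1"
        using card_le[of "{}"] by (simp add: orthonormal_family_def)
      ultimately show False
        using least[OF U, of "n - 1"] by linarith
    qed
    then show ?thesis
      by (auto simp: U_def)
  qed
  then show ?thesis
    using y by blast
qed

section \<open>Rank-one operators and diagonal projections\<close>

lemma hilbert_schmidt_rank_one: "hilbert_schmidt (\<lambda>x. cinner w x *\<^sub>C u)"
proof -
  have "bounded_linear (\<lambda>x. cinner w x *\<^sub>C u)"
  proof (rule bounded_linear_intro[where K = "norm w * norm u"])
    show "cinner w (r *\<^sub>R x) *\<^sub>C u = r *\<^sub>R (cinner w x *\<^sub>C u)" for r x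
      by (simp only: cinner_scaleR_right scaleR_conv_of_real[of r "cinner w x"]
          scaleC_scaleC[symmetric] scaleC_of_real)
    show "norm (cinner w x *\<^sub>C u) \<le> norm x * (norm w * norm u)" for x
      using mult_right_mono[OF cinner_Cauchy_Schwarz[of w x], of "norm u"]
      by (simp add: norm_scaleC algebra_simps)
  qed (simp add: cinner_add_right scaleC_add_left)
  moreover have "(\<lambda>b. (norm (cinner w b *\<^sub>C u))\<^sup>2) summable_on some_basis"
    using Bessel_summable[OF orthonormal_basis_family[OF orthonormal_some_basis], of w]
    by (auto simp: norm_scaleC power_mult_distrib cmod_cinner_commute intro: summable_on_cmult_left)
  ultimately show ?thesis
    by (simp add: hilbert_schmidt_iff bounded_clinear_def cinner_scaleC_right scaleC_scaleC)
qed

lemma bounded_clinear_rank_one: "bounded_clinear (\<lambda>x. cinner w x *\<^sub>C u)" for u w :: "'a::chilbert_space"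
  using hilbert_schmidt_rank_one[of w u] by (simp add: hilbert_schmidt_iff)

lift_definition hs_rank_one :: "'a \<Rightarrow> 'a \<Rightarrow> 'a::chilbert_space hs" is "\<lambda>u w x. cinner w x *\<^sub>C u"
  by (rule hilbert_schmidt_rank_one)

text \<open>This is the trace formula: pairing with rank-one operators reads off the matrix
  coefficients of \<open>T\<close>. It is the Parseval identity for \<open>w\<close> and the image
  of \<open>u\<close> under the adjoint of \<open>T\<close>.\<close>

lemma cinner_hs_rank_one: "cinner (hs_rank_one u w) T = cinner u (hs_op T w)"
proof -
  have "((\<lambda>b. cinner (cadjoint (hs_op T) u) b * cinner b w) has_sum cinner (cadjoint (hs_op T) u) w) some_basis"
    by (rule Parseval_cinner[OF orthonormal_some_basis])
  moreover have "cinner (cadjoint (hs_op T) u) b * cinner b w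
      = cinner (hs_op (hs_rank_one u w) b) (hs_op T b)" for b
    by (simp add: cinner_cadjoint[OF hs_bounded_clinear] hs_rank_one.rep_eq cinner_scaleC_left
        cinner_commute[of b w])
  ultimately show ?thesis
    using hs_cinner_has_sum[of "hs_rank_one u w" T]
    by (simp add: has_sum_unique cinner_cadjoint[OF hs_bounded_clinear])
qed

lemma left_mult_rank_one:
  "left_mult (\<lambda>x. cinner w x *\<^sub>C u) T = hs_rank_one u (cadjoint (hs_op T) w)"
  by (rule hs_eqI)
    (simp add: hs_op_left_mult[OF bounded_clinear_rank_one] hs_rank_one.rep_eq
      cinner_cadjoint[OF hs_bounded_clinear])

lemma diagonal_projection_iff:
  fixes p :: "'a::chilbert_space hs \<Rightarrow> 'a hs"
  shows "diagonal_projection p \<longleftrightarrow> is_projection p \<and>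
    (\<forall>x. bounded_clinear x \<longrightarrow> (\<forall>T. p (left_mult x (p T)) =
      p ((modular_conj \<circ> left_mult (cadjoint x) \<circ> modular_conj) (p T))))"
proof -
  have "bounded_clinear (id :: 'a \<Rightarrow> 'a)"
    using bounded_linear_ident by (simp add: bounded_clinear_def id_def)
  then have "left_mult id T = T" for T :: "'a hs"
    by (intro hs_eqI) (simp add: hs_op_left_mult)
  then show ?thesis
    by (auto simp: diagonal_projection_def tensor_def fun_eq_iff)
qed

text \<open>Testing on the rank-one operators turns the defining property of a diagonal projection into a
  commutation relation on its range.\<close>

lemma diagonal_projection_commute:
  fixes p :: "'a::chilbert_space hs \<Rightarrow> 'a hs"
  assumes p: "diagonal_projection p" and S: "S \<in> range p" and T: "T \<in> range p"
  shows "hs_op S (cadjoint (hs_op T) w) = cadjoint (hs_op T) (hs_op S w)"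
proof (rule cinner_eqI)
  fix u :: 'a
  let ?x = "\<lambda>y. cinner w y *\<^sub>C u"
  have P: "is_projection p"
    using p by (simp add: diagonal_projection_iff)
  have pS: "p S = S" "p T = T"
    using S T is_projection_range_iff[OF P] by blast+
  note x = bounded_clinear_rank_one[of w u]
  let ?R = "(modular_conj \<circ> left_mult (cadjoint ?x) \<circ> modular_conj) T"
  have R: "?R = hs_rank_one (hs_op T u) w"
    by (rule hs_eqI) (simp add: hs_op_right_mult[OF x, unfolded comp_def] hs_rank_one.rep_eq
        bounded_clinear_scaleC[OF hs_bounded_clinear])
  have "p (left_mult ?x T) = p ?R"
    using p x pS by (metis diagonal_projection_iff)
  \<comment> \<open>Pairing with \<open>S\<close>, which \<open>p\<close> fixes, removes the outer
    \<open>p\<close> by symmetry.\<close>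
  then have "cinner (left_mult ?x T) S = cinner ?R S"
    by (metis pS(1) is_projection_symmetric[OF P])
  then have "cinner u (hs_op S (cadjoint (hs_op T) w)) = cinner (hs_op T u) (hs_op S w)"
    unfolding R by (simp add: left_mult_rank_one cinner_hs_rank_one)
  then show "cinner (hs_op S (cadjoint (hs_op T) w)) u = cinner (cadjoint (hs_op T) (hs_op S w)) u"
    by (metis cinner_cadjoint[OF hs_bounded_clinear] cinner_commute)
qed

text \<open>For an orthonormal basis this keeps the diagonal matrix entries and deletes all others.
  It turns out to be the value of the sum in (b).\<close>

definition basis_diagonal_proj :: "'i set \<Rightarrow> ('i \<Rightarrow> 'a) \<Rightarrow> 'a::chilbert_space hs \<Rightarrow> 'a hs"
  where "basis_diagonal_proj I e = orthonormal_proj I (\<lambda>i. hs_rank_one (e i) (e i))"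

lemma orthonormal_family_rank_one:
  "orthonormal_family I e \<Longrightarrow> orthonormal_family I (\<lambda>i. hs_rank_one (e i) (e i))"
  by (auto simp: orthonormal_family_def cinner_hs_rank_one hs_rank_one.rep_eq cinner_scaleC_right)

section \<open>Operators that are diagonal in a fixed orthonormal basis\<close>

context
  fixes I :: "'i set" and e :: "'i \<Rightarrow> 'a::chilbert_space"
  assumes basis: "orthonormal_basis I e"
begin

lemma cinner_basis: "i \<in> I \<Longrightarrow> j \<in> I \<Longrightarrow> cinner (e i) (e j) = (if i = j then 1 else 0)"
  using basis by (simp add: orthonormal_basis_def orthonormal_family_def)

lemma orthonormal_basis_rank_one: "orthonormal_family I (\<lambda>i. hs_rank_one (e i) (e i))"
  by (intro orthonormal_family_rank_one orthonormal_basis_family basis)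

lemma is_projection_basis_diagonal_proj: "is_projection (basis_diagonal_proj I e)"
  unfolding basis_diagonal_proj_def by (intro is_projection_orthonormal_proj orthonormal_basis_rank_one)

lemma hs_op_basis_diagonal_proj:
  assumes j: "j \<in> I"
  shows "hs_op (basis_diagonal_proj I e T) (e j) = cinner (e j) (hs_op T (e j)) *\<^sub>C e j"
proof -
  have "((\<lambda>i. hs_op (cinner (hs_rank_one (e i) (e i)) T *\<^sub>C hs_rank_one (e i) (e i)) (e j)) has_sum
      hs_op (basis_diagonal_proj I e T) (e j)) I"
    unfolding basis_diagonal_proj_def
    by (intro has_sum_bounded_linear[OF bounded_linear_hs_op_apply] orthonormal_proj_has_sum
        orthonormal_basis_rank_one)
  moreover have "((\<lambda>i. hs_op (cinner (hs_rank_one (e i) (e i)) T *\<^sub>C hs_rank_one (e i) (e i)) (e j)) has_sum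
      cinner (e j) (hs_op T (e j)) *\<^sub>C e j) I"
    using j by (intro has_sum_finite_neutralI[of "{j}"])
      (auto simp: scaleC_hs.rep_eq hs_rank_one.rep_eq cinner_hs_rank_one cinner_basis)
  ultimately show ?thesis
    by (rule has_sum_unique)
qed

text \<open>An operator that is diagonal on the basis agrees there with its diagonal part, and
  bounded operators are determined by their values on a basis.\<close>

lemma range_basis_diagonal_proj_iff:
  "T \<in> range (basis_diagonal_proj I e) \<longleftrightarrow> (\<forall>i\<in>I. \<exists>c. hs_op T (e i) = c *\<^sub>C e i)"
proof -
  have "basis_diagonal_proj I e T = T" if T: "\<And>i. i \<in> I \<Longrightarrow> \<exists>c. hs_op T (e i) = c *\<^sub>C e i"
  proof -
    have "hs_op (basis_diagonal_proj I e T) (e i) = hs_op T (e i)" if "i \<in> I" for i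
      using T[OF that] that by (auto simp: hs_op_basis_diagonal_proj cinner_scaleC_right cinner_basis)
    then have "hs_op (basis_diagonal_proj I e T) = hs_op T"
      by (intro bounded_clinear_eq_on_basis[OF hs_bounded_clinear hs_bounded_clinear basis])
    then show ?thesis
      by (simp add: hs_op_inject)
  qed
  then show ?thesis
    unfolding is_projection_range_iff[OF is_projection_basis_diagonal_proj]
    by (metis hs_op_basis_diagonal_proj)
qed

text \<open>The projection only sees diagonal entries. If \<open>R\<close> is diagonal with entries
  \<open>c i\<close>, then its products with \<open>x\<close> in both orders have the same diagonal,
  namely that of \<open>x\<close> multiplied by \<open>c i\<close>.\<close>

lemma diagonal_projection_basis_diagonal_proj: "diagonal_projection (basis_diagonal_proj I e)"
  unfolding diagonal_projection_iff
proof (intro conjI allI impI is_projection_basis_diagonal_proj)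
  fix x :: "'a \<Rightarrow> 'a" and T
  assume x: "bounded_clinear x"
  define R where "R = basis_diagonal_proj I e T"
  note lin = hs_bounded_clinear[of R]
  have "cinner (e i) (x (hs_op R (e i))) = cinner (e i) (hs_op R (x (e i)))" if i: "i \<in> I" for i
  proof -
    define c where "c j = cinner (e j) (hs_op T (e j))" for j
    have c: "hs_op R (e j) = c j *\<^sub>C e j" if "j \<in> I" for j
      unfolding R_def c_def by (rule hs_op_basis_diagonal_proj[OF that])
    have "cadjoint (hs_op R) (e i) - cnj (c i) *\<^sub>C e i = 0"
      using i by (intro orthonormal_basis_zeroI[OF basis])
        (simp add: cinner_diff_right cinner_cadjoint_right[OF lin] c cinner_scaleC_left
          cinner_scaleC_right cinner_basis)
    then have "cinner (e i) (hs_op R (x (e i))) = cinner (cnj (c i) *\<^sub>C e i) (x (e i))"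
      by (simp add: cinner_cadjoint[OF lin, symmetric])
    then show ?thesis
      using i by (simp add: c bounded_clinear_scaleC[OF x] cinner_scaleC_left cinner_scaleC_right)
  qed
  then have "basis_diagonal_proj I e (left_mult x R) =
      basis_diagonal_proj I e ((modular_conj \<circ> left_mult (cadjoint x) \<circ> modular_conj) R)"
    unfolding basis_diagonal_proj_def orthonormal_proj_def
    by (intro infsum_cong) (simp add: cinner_hs_rank_one hs_op_left_mult[OF x]
        hs_op_right_mult[OF x, unfolded comp_def])
  then show "basis_diagonal_proj I e (left_mult x (basis_diagonal_proj I e T)) =
      basis_diagonal_proj I e ((modular_conj \<circ> left_mult (cadjoint x) \<circ> modular_conj) (basis_diagonal_proj I e T))"
    unfolding R_def .
qed

lemma maximal_diagonal_projection_basis_diagonal_proj: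
  "maximal_diagonal_projection (basis_diagonal_proj I e)"
  unfolding maximal_diagonal_projection_def
proof (intro conjI allI impI diagonal_projection_basis_diagonal_proj)
  let ?D = "basis_diagonal_proj I e"
  fix q assume "diagonal_projection q \<and> operator_le ?D q"
  then have q: "diagonal_projection q" and le: "operator_le ?D q"
    by auto
  have Q: "is_projection q"
    using q by (simp add: diagonal_projection_iff)
  have sub: "range ?D \<subseteq> range q"
    using le operator_le_projection_iff[OF is_projection_basis_diagonal_proj Q] by simp
  have "S \<in> range ?D" if S: "S \<in> range q" for S
    unfolding range_basis_diagonal_proj_iff
  proof
    fix i assume i: "i \<in> I"
    let ?E = "hs_rank_one (e i) (e i)"
    have "?E \<in> range ?D"
      unfolding range_basis_diagonal_proj_iff
    proof
      fix j assume "j \<in> I"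
      then show "\<exists>c. hs_op ?E (e j) = c *\<^sub>C e j"
        by (intro exI[of _ "if i = j then 1 else 0"]) (simp add: hs_rank_one.rep_eq i cinner_basis)
    qed
    then have "?E \<in> range q"
      using sub by blast
    \<comment> \<open>Evaluated at \<open>e i\<close>, the left side is the image of
      \<open>e i\<close> under \<open>S\<close>, while the right side is the component of this image
      along \<open>e i\<close>.\<close>
    then have "hs_op S (cadjoint (hs_op ?E) (e i)) = cadjoint (hs_op ?E) (hs_op S (e i))"
      by (rule diagonal_projection_commute[OF q S])
    moreover have "cadjoint (hs_op ?E) = hs_op ?E"
      by (rule cadjoint_eqI)
        (simp add: hs_rank_one.rep_eq cinner_scaleC_left cinner_scaleC_right cinner_commute[of _ "e i", symmetric])
    ultimately have "hs_op S (e i) = cinner (e i) (hs_op S (e i)) *\<^sub>C e i"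
      using i by (simp add: hs_rank_one.rep_eq cinner_basis)
    then show "\<exists>c. hs_op S (e i) = c *\<^sub>C e i" ..
  qed
  then show "q = ?D"
    using sub by (intro is_projection_eq[OF Q is_projection_basis_diagonal_proj]) blast
qed

end

section \<open>From a maximal diagonal projection to an orthonormal basis\<close>

lemma maximal_diagonal_projection_has_basis:
  fixes p :: "'a::chilbert_space hs \<Rightarrow> 'a hs"
  assumes p: "maximal_diagonal_projection p"
  obtains E where "orthonormal_basis E (\<lambda>x. x)" "p = basis_diagonal_proj E (\<lambda>x. x)"
proof -
  have diag: "diagonal_projection p" and max: "\<And>q. diagonal_projection q \<Longrightarrow> operator_le p q \<Longrightarrow> q = p"
    using p by (auto simp: maximal_diagonal_projection_def)
  define \<K> where "\<K> = hs_op ` range p"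
  define S where "S = {y. \<forall>R\<in>\<K>. \<exists>c. R y = c *\<^sub>C y}"
  have hs: "hilbert_schmidt R" and lin: "bounded_clinear R" if "R \<in> \<K>" for R
    using that hs_op by (auto simp: \<K>_def hs_bounded_clinear)
  have comm: "R (cadjoint T x) = cadjoint T (R x)" if "R \<in> \<K>" "T \<in> \<K>" for R T x
    using that diagonal_projection_commute[OF diag] unfolding \<K>_def by blast
  obtain E where E: "E \<subseteq> S" "orthonormal_family E (\<lambda>x. x)"
    and Emax: "\<And>u. u \<in> S \<Longrightarrow> cinner u u = 1 \<Longrightarrow> \<exists>e\<in>E. cinner e u \<noteq> 0"
    using maximal_orthonormal_subset[of S] by blast
  \<comment> \<open>The orthogonal complement of \<open>E\<close> is invariant, since each
    \<open>e\<close> in \<open>E\<close> is an eigenvector of every member and of its adjoint. If it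
    were nonzero, it would contain a further joint eigenvector, against the maximality of
    \<open>E\<close>.\<close>
  define W where "W = {x. \<forall>e\<in>E. cinner e x = 0}"
  have W: "complex_vector.subspace W" "closed W"
  proof -
    show "complex_vector.subspace W"
      by (simp add: W_def complex_vector.subspace_def cinner_add_right cinner_scaleC_right)
    have "W = (\<Inter>e\<in>E. {x. cinner e x = 0})"
      by (auto simp: W_def)
    moreover have "closed {x. cinner e x = 0}" for e :: 'a
      by (intro closed_Collect_eq continuous_on_const continuous_on_id
          bounded_linear.continuous_on[OF bounded_linear_cinner_right])
    ultimately show "closed W"
      by (simp add: closed_INT)
  qed
  have inv: "R x \<in> W" "cadjoint R x \<in> W" if R: "R \<in> \<K>" and x: "x \<in> W" for R x
  proof -
    have "cinner e (R x) = 0 \<and> cinner e (cadjoint R x) = 0" if e: "e \<in> E" for e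
    proof -
      obtain c where c: "R e = c *\<^sub>C e"
        using e E R by (auto simp: S_def)
      have "cadjoint R e = cnj c *\<^sub>C e"
        by (rule normal_eigenvector_cadjoint[OF lin[OF R] comm[OF R R] c])
      then have "cinner e (R x) = cinner (cnj c *\<^sub>C e) x"
        by (simp add: cinner_cadjoint[OF lin[OF R], symmetric])
      moreover have "cinner e (cadjoint R x) = cinner (c *\<^sub>C e) x"
        by (simp add: cinner_cadjoint_right[OF lin[OF R]] c)
      ultimately show ?thesis
        using x e by (simp add: cinner_scaleC_left W_def)
    qed
    then show "R x \<in> W" "cadjoint R x \<in> W"
      by (auto simp: W_def)
  qed
  have basis: "orthonormal_basis E (\<lambda>x. x)"
  proof (rule orthonormal_basisI[OF E(2)], rule ccontr)
    fix x assume "\<And>e. e \<in> E \<Longrightarrow> cinner e x = 0" and x: "x \<noteq> 0"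
    then have xW: "x \<in> W"
      by (simp add: W_def)
    have "\<exists>y\<in>W. y \<noteq> 0 \<and> (\<forall>R\<in>\<K>. \<exists>c. R y = c *\<^sub>C y)"
      by (rule hs_joint_eigenvector_in[where w = x]) (fact hs comm W inv xW x)+
    then obtain y where y: "y \<noteq> 0" "y \<in> W" "\<And>R. R \<in> \<K> \<Longrightarrow> \<exists>c. R y = c *\<^sub>C y"
      by blast
    have "R (sgn y) = c *\<^sub>C sgn y" if "R \<in> \<K>" "R y = c *\<^sub>C y" for R c
    proof -
      have "sgn y = complex_of_real (inverse (norm y)) *\<^sub>C y"
        by (simp only: sgn_div_norm scaleC_of_real)
      then show ?thesis
        using that by (simp add: bounded_clinear_scaleC[OF lin] scaleC_scaleC mult.commute)
    qed
    then have "sgn y \<in> S"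
      using y(3) unfolding S_def by blast
    then obtain e where "e \<in> E" "cinner e (sgn y) \<noteq> 0"
      using Emax cinner_sgn_self[OF y(1)] by blast
    then show False
      using y(2) cinner_sgn_zero by (auto simp: W_def)
  qed
  let ?D = "basis_diagonal_proj E (\<lambda>x. x)"
  have "range p \<subseteq> range ?D"
  proof
    fix T assume "T \<in> range p"
    then show "T \<in> range ?D"
      using E(1) unfolding range_basis_diagonal_proj_iff[OF basis] by (auto simp: S_def \<K>_def)
  qed
  then have "operator_le p ?D"
    using diag is_projection_basis_diagonal_proj[OF basis]
    by (subst operator_le_projection_iff) (auto simp: diagonal_projection_iff)
  then have "?D = p"
    by (intro max diagonal_projection_basis_diagonal_proj basis)
  then show ?thesis
    using that basis by blast
qed

section \<open>\<open>\<sigma>\<close>-strong convergence\<close>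

text \<open>Convergence can be tested on a subbasis, because eventual membership passes to finite
  intersections and to unions.\<close>

lemma limitin_topology_generated_by:
  assumes l: "l \<in> \<Union>\<S>" and ev: "\<And>U. U \<in> \<S> \<Longrightarrow> l \<in> U \<Longrightarrow> eventually (\<lambda>x. f x \<in> U) F"
  shows "limitin (topology_generated_by \<S>) f l F"
  unfolding limitin_def
proof (intro conjI allI impI)
  show "l \<in> topspace (topology_generated_by \<S>)"
    using l by simp
  fix U assume "openin (topology_generated_by \<S>) U \<and> l \<in> U"
  then have "generate_topology_on \<S> U" "l \<in> U"
    by (auto simp: openin_topology_generated_by_iff)
  then show "eventually (\<lambda>x. f x \<in> U) F"
  proof (induction rule: generate_topology_on.induct)
    case (UN K)
    then obtain k where "k \<in> K" "l \<in> k"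
      by blast
    with UN.IH have "eventually (\<lambda>x. f x \<in> k) F"
      by blast
    then show ?case
      by eventually_elim (use \<open>k \<in> K\<close> in blast)
  qed (auto simp: eventually_conj_iff ev)
qed

text \<open>Uniformly bounded nets that converge strongly converge \<sigma>-strongly, by dominated
  convergence for series.\<close>

lemma limitin_sigma_strongI:
  assumes p: "bounded_clinear p" and nt: "G \<noteq> bot"
    and lim: "\<And>x. ((\<lambda>i. T i x) \<longlongrightarrow> p x) G"
    and bnd: "eventually (\<lambda>i. bounded_clinear (T i) \<and> (\<forall>x. norm (T i x) \<le> C * norm x)) G"
  shows "limitin sigma_strong_topology T p G"
  unfolding sigma_strong_topology_def
proof (rule limitin_topology_generated_by)
  \<comment> \<open>The zero sequence \<open>\<xi>\<close> gives a subbasic set that contains all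
    bounded operators.\<close>
  show "p \<in> \<Union>{{T. bounded_clinear T \<and> sqrt (\<Sum>n. (norm (T (\<xi> n) - S (\<xi> n)))\<^sup>2) < \<epsilon>} | S (\<xi> :: nat \<Rightarrow> 'a) \<epsilon>.
      bounded_clinear S \<and> summable (\<lambda>n. (norm (\<xi> n))\<^sup>2) \<and> \<epsilon> > 0}"
    using p by (intro UnionI[OF CollectI], intro exI[of _ p] exI[of _ "\<lambda>_. 0"] exI[of _ 1] conjI refl) auto
next
  fix U assume "U \<in> {{T. bounded_clinear T \<and> sqrt (\<Sum>n. (norm (T (\<xi> n) - S (\<xi> n)))\<^sup>2) < \<epsilon>} | S (\<xi> :: nat \<Rightarrow> 'a) \<epsilon>.
      bounded_clinear S \<and> summable (\<lambda>n. (norm (\<xi> n))\<^sup>2) \<and> \<epsilon> > 0}" and "p \<in> U"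
  then obtain S and \<xi> :: "nat \<Rightarrow> 'a" and \<epsilon> where S: "bounded_clinear S" and \<xi>: "summable (\<lambda>n. (norm (\<xi> n))\<^sup>2)"
    and U: "U = {T. bounded_clinear T \<and> sqrt (\<Sum>n. (norm (T (\<xi> n) - S (\<xi> n)))\<^sup>2) < \<epsilon>}"
    and pU: "sqrt (\<Sum>n. (norm (p (\<xi> n) - S (\<xi> n)))\<^sup>2) < \<epsilon>"
    by auto
  obtain K where K: "\<And>x. norm (S x) \<le> norm x * K"
    using bounded_linear.bounded[OF bounded_clinear_linear[OF S]] by blast
  \<comment> \<open>The subbasic set is centred at \<open>S\<close>, which may differ from
    \<open>p\<close>. So the whole seminorm has to converge to its value at \<open>p\<close>, which
    is below \<open>\<epsilon>\<close>.\<close>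
  have "((\<lambda>i. \<Sum>n. (norm (T i (\<xi> n) - S (\<xi> n)))\<^sup>2) \<longlongrightarrow> (\<Sum>n. (norm (p (\<xi> n) - S (\<xi> n)))\<^sup>2)) G"
  proof (rule conjunct2[OF conjunct2[OF tannerys_theorem]])
    show "((\<lambda>i. (norm (T i (\<xi> n) - S (\<xi> n)))\<^sup>2) \<longlongrightarrow> (norm (p (\<xi> n) - S (\<xi> n)))\<^sup>2) G" for n
      by (intro tendsto_intros lim)
    show "summable (\<lambda>n. (C + K)\<^sup>2 * (norm (\<xi> n))\<^sup>2)"
      by (intro summable_mult \<xi>)
    have "norm ((norm (T i (\<xi> n) - S (\<xi> n)))\<^sup>2) \<le> (C + K)\<^sup>2 * (norm (\<xi> n))\<^sup>2"
      if "\<forall>x. norm (T i x) \<le> C * norm x" for i n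
    proof -
      have "norm (T i (\<xi> n) - S (\<xi> n)) \<le> norm (T i (\<xi> n)) + norm (S (\<xi> n))"
        by (rule norm_triangle_ineq4)
      also have "\<dots> \<le> (C + K) * norm (\<xi> n)"
        using that[rule_format, of "\<xi> n"] K[of "\<xi> n"] by (simp add: algebra_simps)
      finally show ?thesis
        by (simp add: power_mono flip: power_mult_distrib)
    qed
    then show "eventually (\<lambda>(n, i). norm ((norm (T i (\<xi> n) - S (\<xi> n)))\<^sup>2) \<le> (C + K)\<^sup>2 * (norm (\<xi> n))\<^sup>2)
        (at_top \<times>\<^sub>F G)"
      unfolding eventually_prod_filter using bnd eventually_True by (smt (verit) case_prod_conv)
  qed (rule nt)
  then have "((\<lambda>i. sqrt (\<Sum>n. (norm (T i (\<xi> n) - S (\<xi> n)))\<^sup>2)) \<longlongrightarrow> sqrt (\<Sum>n. (norm (p (\<xi> n) - S (\<xi> n)))\<^sup>2)) G"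
    by (rule tendsto_real_sqrt)
  from order_tendstoD(2)[OF this pU] bnd show "eventually (\<lambda>i. T i \<in> U) G"
    by eventually_elim (simp add: U)
qed

text \<open>A sequence whose only possibly nonzero term is \<open>x\<close> turns the
  \<sigma>-strong seminorm into the norm at \<open>x\<close>.\<close>

lemma limitin_sigma_strongD:
  assumes lim: "limitin sigma_strong_topology T p G" and p: "bounded_clinear p"
  shows "((\<lambda>i. T i x) \<longlongrightarrow> p x) G"
proof (rule tendstoI)
  fix d :: real assume d: "d > 0"
  define \<xi> where "\<xi> n = (if n = 0 then x else 0)" for n :: nat
  define U where "U = {S. bounded_clinear S \<and> sqrt (\<Sum>n. (norm (S (\<xi> n) - p (\<xi> n)))\<^sup>2) < d}"
  have sum: "(\<lambda>n. (norm (\<xi> n))\<^sup>2) sums (norm x)\<^sup>2"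
  proof -
    have "(norm (\<xi> n))\<^sup>2 = (if n \<in> {0} then (norm x)\<^sup>2 else 0)" for n
      by (simp add: \<xi>_def)
    then show ?thesis
      using sums_If_finite_set[of "{0::nat}" "\<lambda>_. (norm x)\<^sup>2"] by simp
  qed
  have "openin sigma_strong_topology U"
    unfolding sigma_strong_topology_def U_def using p d sum
    by (intro topology_generated_by_Basis CollectI exI conjI refl) (auto simp: sums_iff)
  moreover have "p \<in> U"
    using p d by (simp add: U_def)
  ultimately have "eventually (\<lambda>i. T i \<in> U) G"
    using lim by (simp add: limitin_def)
  then show "eventually (\<lambda>i. dist (T i x) (p x) < d) G"
  proof eventually_elim
    case (elim i)
    then have lin: "bounded_clinear (T i)"
      by (simp add: U_def)
    have "T i 0 = 0" "p 0 = 0"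
      using bounded_clinear_scaleC[OF lin, of 0 0] bounded_clinear_scaleC[OF p, of 0 0] by simp_all
    then have "(norm (T i (\<xi> n) - p (\<xi> n)))\<^sup>2 = (if n \<in> {0} then (norm (T i x - p x))\<^sup>2 else 0)" for n
      by (simp add: \<xi>_def)
    then have "(\<Sum>n. (norm (T i (\<xi> n) - p (\<xi> n)))\<^sup>2) = (norm (T i x - p x))\<^sup>2"
      using sums_If_finite_set[of "{0}" "\<lambda>_. (norm (T i x - p x))\<^sup>2"] by (simp add: sums_iff)
    then show ?case
      using elim by (simp add: U_def dist_norm)
  qed
qed

text \<open>The partial sums converge pointwise and, being projections, are uniformly bounded by
  1.\<close>

lemma limitin_sigma_strong_orthonormal_proj:
  assumes on: "orthonormal_family I e"
  shows "limitin sigma_strong_topology (\<lambda>F. orthonormal_proj F e) (orthonormal_proj I e) (finite_subsets_at_top I)"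
proof (rule limitin_sigma_strongI[where C = 1])
  show "bounded_clinear (orthonormal_proj I e)"
    by (intro is_projection_bounded is_projection_orthonormal_proj on)
  show "((\<lambda>F. orthonormal_proj F e x) \<longlongrightarrow> orthonormal_proj I e x) (finite_subsets_at_top I)" for x
    using orthonormal_proj_has_sum[OF on, of x] unfolding has_sum_def
    by (rule tendsto_cong[THEN iffD1, rotated])
      (auto intro!: eventually_finite_subsets_at_top_weakI simp: orthonormal_proj_def)
  show "\<forall>\<^sub>F F in finite_subsets_at_top I. bounded_clinear (orthonormal_proj F e) \<and>
      (\<forall>x. norm (orthonormal_proj F e x) \<le> 1 * norm x)"
  proof (rule eventually_finite_subsets_at_top_weakI)
    fix F assume "F \<subseteq> I"
    then have "orthonormal_family F e"
      using on unfolding orthonormal_family_def by blast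
    then have "is_projection (orthonormal_proj F e)"
      by (rule is_projection_orthonormal_proj)
    then show "bounded_clinear (orthonormal_proj F e) \<and> (\<forall>x. norm (orthonormal_proj F e x) \<le> 1 * norm x)"
      by (simp add: is_projection_bounded is_projection_norm_le)
  qed
qed simp

text \<open>The elementary tensor multiplies \<open>\<rho>\<close> by \<open>P\<close> on both
  sides, which leaves one diagonal coefficient times the rank-one projection.\<close>

lemma tensor_projection_onto_line:
  fixes e :: "'a::chilbert_space"
  assumes e: "cinner e e = 1"
  defines "P \<equiv> projection_onto (cspan {e})"
  shows "tensor P (modular_conj \<circ> left_mult P \<circ> modular_conj) \<rho>
    = cinner (hs_rank_one e e) \<rho> *\<^sub>C hs_rank_one e e"
proof -
  have P: "P = (\<lambda>x. cinner e x *\<^sub>C e)"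
    unfolding P_def by (rule projection_onto_line[OF e])
  have lin: "bounded_clinear P"
    unfolding P by (rule bounded_clinear_rank_one)
  have adj: "cadjoint P = P"
    unfolding P by (rule cadjoint_eqI)
      (simp add: cinner_scaleC_left cinner_scaleC_right cinner_commute[of _ e, symmetric])
  have right: "hs_op (modular_conj (left_mult P (modular_conj \<rho>))) x = hs_op \<rho> (P x)" for x
    using hs_op_right_mult[OF lin, of \<rho>, unfolded adj] by (simp add: fun_eq_iff)
  show ?thesis
  proof (rule hs_eqI)
    fix x
    have "hs_op (tensor P (modular_conj \<circ> left_mult P \<circ> modular_conj) \<rho>) x = P (hs_op \<rho> (P x))"
      by (simp add: tensor_def hs_op_left_mult[OF lin] right)
    then show "hs_op (tensor P (modular_conj \<circ> left_mult P \<circ> modular_conj) \<rho>) x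
        = hs_op (cinner (hs_rank_one e e) \<rho> *\<^sub>C hs_rank_one e e) x"
      by (simp add: P cinner_hs_rank_one scaleC_hs.rep_eq hs_rank_one.rep_eq
          bounded_clinear_scaleC[OF hs_bounded_clinear] cinner_scaleC_right scaleC_scaleC mult.commute)
  qed
qed

text \<open>The partial sums in (b) are finite orthonormal projections in the Hilbert-Schmidt space.
  Their limit is unique because \<sigma>-strong convergence implies pointwise convergence in
  norm.\<close>

lemma limitin_tensor_sum_iff:
  fixes e :: "'i \<Rightarrow> 'a::chilbert_space"
  assumes basis: "orthonormal_basis I e" and p: "bounded_clinear p"
  shows "limitin sigma_strong_topology
        (\<lambda>F \<rho>. \<Sum>i\<in>F. tensor (projection_onto (cspan {e i}))
          (modular_conj \<circ> left_mult (projection_onto (cspan {e i})) \<circ> modular_conj) \<rho>)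
        p (finite_subsets_at_top I) \<longleftrightarrow> p = basis_diagonal_proj I e"
    (is "limitin _ ?T p ?G \<longleftrightarrow> _")
proof -
  let ?E = "\<lambda>i. hs_rank_one (e i) (e i)"
  have ev: "\<forall>\<^sub>F F in ?G. orthonormal_proj F ?E = ?T F"
  proof (rule eventually_finite_subsets_at_top_weakI)
    fix F assume F: "finite F" "F \<subseteq> I"
    show "orthonormal_proj F ?E = ?T F"
      using F cinner_basis[OF basis]
      by (auto simp: orthonormal_proj_def tensor_projection_onto_line subset_iff intro!: ext sum.cong)
  qed
  have "limitin sigma_strong_topology (\<lambda>F. orthonormal_proj F ?E) (basis_diagonal_proj I e) ?G"
    unfolding basis_diagonal_proj_def
    by (intro limitin_sigma_strong_orthonormal_proj orthonormal_basis_rank_one basis)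
  then have lim: "limitin sigma_strong_topology ?T (basis_diagonal_proj I e) ?G"
    by (rule limitin_transform_eventually[OF ev])
  have "p = basis_diagonal_proj I e" if "limitin sigma_strong_topology ?T p ?G"
  proof
    fix x
    show "p x = basis_diagonal_proj I e x"
      using limitin_sigma_strongD[OF that p, of x]
        limitin_sigma_strongD[OF lim is_projection_bounded[OF is_projection_basis_diagonal_proj[OF basis]], of x]
      by (rule tendsto_unique[rotated]) simp
  qed
  then show ?thesis
    using lim by blast
qed

theorem proposition4p6:
  fixes p :: "'a::chilbert_space hs \<Rightarrow> 'a hs"
  assumes "is_projection p"
  shows "maximal_diagonal_projection p \<longleftrightarrow>
    (\<exists>(I :: 'a set) (e :: 'a \<Rightarrow> 'a). orthonormal_basis I e \<and>
      limitin sigma_strong_topology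
        (\<lambda>F \<rho>. \<Sum>i\<in>F. tensor (projection_onto (cspan {e i}))
          (modular_conj \<circ> left_mult (projection_onto (cspan {e i})) \<circ> modular_conj) \<rho>)
        p (finite_subsets_at_top I))"
proof -
  \<comment> \<open>The basis obtained from a maximal diagonal projection is a set of vectors
    indexed by itself, so index sets inside \<open>'a\<close> suffice.\<close>
  have "maximal_diagonal_projection p \<longleftrightarrow>
      (\<exists>(I :: 'a set) (e :: 'a \<Rightarrow> 'a). orthonormal_basis I e \<and> p = basis_diagonal_proj I e)"
    using maximal_diagonal_projection_has_basis maximal_diagonal_projection_basis_diagonal_proj by metis
  then show ?thesis
    by (elim trans, intro ex_cong1 conj_cong refl limitin_tensor_sum_iff[symmetric] is_projection_bounded assms)
qed

end
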